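(* Let $\delta>0$, $q>0$ be constants and let $L(t)$, $T_m(t)$ be given functions of $t>0$. Let $T=T(y,t)$, $S=S(t)$ be the solution to the Stefan problem $$T_t=T_{yy},\quad 0<y<S(t),\ t>0,$$ $$-T_y(S(t),t)=L(t)\dot S(t),\quad T(S(t),t)=T_m(t),\quad T_y(0,t)=-q,\quad t>0,\qquad S(0)=0.$$ Then the solution to the problem $$\frac{\partial\Psi}{\partial t}=\frac{\partial}{\partial x^*}\left(\frac{\Psi_{x^*}}{\Psi^2}\right)+2\delta,\quad X_0^*(t)<x^*<X_1^*(t),\ t>0,$$ with the conditions, for $t>0$, (i) $\displaystyle \frac{1}{\Psi(X_1^*(t),t)}-\delta {X_1^*}^2(t)=-\frac{L(t)}{\delta C(t)}\left(\Psi(X_1^*(t),t)\dot X_1^*(t)+\frac{\Psi_{x^*}(X_1^*(t),t)}{\Psi^2(X_1^*(t),t)}+2\delta X_1^*(t)\right)$, (ii) $\displaystyle \frac{1}{\Psi(X_0^*(t),t)}-\delta {X_0^*}^2(t)=\frac{-q\exp\left(\int_0^tH(\tau)\,d\tau\right)}{\delta C(t)}$, (iii) $\displaystyle \dot C(t)=[L(t)-T_m(t)]\left[\Psi(X_1^*(t),t)\dot X_1^*(t)+\frac{\Psi_{x^*}(X_1^*(t),t)}{\Psi^2(X_1^*(t),t)}+2\delta X_1^*(t)\right]$, where, for $t>0$, $$X_0^*(t)=-\int_0^t\left(\frac{\Psi_{x^*}(X_0^*(\tau),\tau)}{\Psi^3(X_0^*(\tau),\tau)}+2\delta\frac{X_0^*(\tau)}{\Psi(X_0^*(\tau),\tau)}\right)d\tau,\qquad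 X_1^*(t)=\frac{T_m(t)}{\delta C(t)},$$ and $$H(t)=-\frac{T_m^3(t)}{L(t)C^2(t)}+\delta\frac{T_m(t)}{L(t)}\frac{1}{\Psi(X_1^*(t),t)}-\frac{\delta}{\Psi(X_1^*(t),t)}+\frac{T_m^2(t)}{C^2(t)}+\frac{\delta}{\Psi(X_0^*(t),t)}-\delta^2{X_0^*}^2(t),$$ is obtained from the solution $T,S$ of the Stefan problem, and its parametric expression (with parameter $y$) is given by $$\Psi(x^*,t)=\frac{\delta\left[C(t)-\int_{S(t)}^{y}T(u,t)\,du\right]^2}{T_y(y,t)\left[C(t)-\int_{S(t)}^{y}T(u,t)\,du\right]+T^2(y,t)},\quad X_0^*(t)<x^*<X_1^*(t),\ t>0,$$ $$x^*=\frac{T(y,t)}{\delta\left[C(t)-\int_{S(t)}^{y}T(u,t)\,du\right]},\quad 0<y<S(t),\ t>0,$$ where $$C(t)=\int_0^t[L(\tau)-T_m(\tau)]\dot S(\tau)\,d\tau,\quad t>0,$$ $$X_0^*(t)=\frac{T(0,t)}{\delta\left[C(t)-\int_{S(t)}^{0}T(u,t)\,du\right]},\qquad X_1^*(t)=\frac{T_m(t)}{\delta C(t)}.$$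
   Context: Subscripts $t$, $y$, $x^*$ denote partial derivatives and a dot denotes $d/dt$. The function $C$ is assumed to satisfy $C(t)>0$ for $t>0$ and $C(0)=0$. The problem for $\Psi$ has two free boundaries $X_0^*$ and $X_1^*$.
   Formalization: The conditions with integrals from 0 are shown to hold exactly when, as t→0+, X0*→0 and C(t)/[C(t)+∫_0^{S(t)}T du]→1; otherwise from each s>0. The region lies between X0* and X1* in either order; T,S are classical up to the boundary, L and denominators nonzero. *)

theory Defs
  imports "HOL-Analysis.Analysis"
begin

text \<open>
  Partial derivative in the space variable of \<open>u\<close>, where \<open>u(\<cdot>, t)\<close> is considered on the closed
  interval \<open>D t\<close> only: two-sided in the interior, one-sided at the end points.  In this way
  \<open>T\<^sub>y(0,t)\<close>, \<open>T\<^sub>y(S(t),t)\<close>, \<open>\<Psi>\<^sub>x(X\<^sub>0(t),t)\<close>, \<open>\<Psi>\<^sub>x(X\<^sub>1(t),t)\<close> do not depend on values outside the region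
  in which the function solves its equation.
\<close>
definition dspace :: "(real \<Rightarrow> real set) \<Rightarrow> (real \<Rightarrow> real \<Rightarrow> real) \<Rightarrow> real \<Rightarrow> real \<Rightarrow> real" where
  "dspace D u x t = vector_derivative (\<lambda>z. u z t) (at x within D t)"

definition region :: "(real \<Rightarrow> real set) \<Rightarrow> (real \<times> real) set" where
  "region D = {(x, t). t > 0 \<and> x \<in> D t}"

definition stefan_strip :: "(real \<Rightarrow> real) \<Rightarrow> real \<Rightarrow> real set" where
  "stefan_strip S t = {0..S t}"

text \<open>
  Classical solutions.  \<open>T\<close>, \<open>T\<^sub>y\<close>, \<open>T\<^sub>y\<^sub>y\<close> are continuous up to the two lateral boundaries for \<open>t > 0\<close>,
  because the problem for \<open>\<Psi>\<close> evaluates \<open>\<Psi>\<^sub>x\<close>, which involves \<open>T\<^sub>y\<^sub>y\<close>, on its free boundaries; the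
  term \<open>(\<Psi>\<^sub>x/\<Psi>\<^sup>2)\<^sub>x\<close> involves \<open>T\<^sub>y\<^sub>y\<^sub>y\<close>, which is required in the interior only.  Nothing is
  required of \<open>T\<close> or of \<open>dS/dt\<close> as \<open>t\<close> tends to \<open>0\<close>.
\<close>
definition stefan_solution ::
  "real \<Rightarrow> (real \<Rightarrow> real) \<Rightarrow> (real \<Rightarrow> real) \<Rightarrow> (real \<Rightarrow> real \<Rightarrow> real) \<Rightarrow> (real \<Rightarrow> real) \<Rightarrow> bool" where
  "stefan_solution q L Tm T S \<longleftrightarrow>
    (let D = stefan_strip S; Ty = dspace D T; Tyy = dspace D Ty; Tyyy = dspace D Tyy in
      \<comment> \<open>regularity\<close>
      S 0 = 0 \<and> continuous_on {0..} S \<and> (\<forall>t>0. S t > 0) \<and>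
      (\<forall>t>0. S differentiable (at t)) \<and> continuous_on {0<..} (deriv S) \<and>
      (\<forall>t>0. (\<lambda>z. T z t) differentiable_on D t \<and> (\<lambda>z. Ty z t) differentiable_on D t) \<and>
      continuous_on (region D) (\<lambda>(y, t). T y t) \<and>
      continuous_on (region D) (\<lambda>(y, t). Ty y t) \<and>
      continuous_on (region D) (\<lambda>(y, t). Tyy y t) \<and>
      (\<forall>t>0. \<forall>y\<in>{0<..<S t}. (\<lambda>z. Tyy z t) differentiable (at y)) \<and>
      continuous_on (region (\<lambda>t. {0<..<S t})) (\<lambda>(y, t). Tyyy y t) \<and>
      \<comment> \<open>heat equation and boundary conditions\<close>
      (\<forall>t>0. \<forall>y\<in>{0<..<S t}. ((\<lambda>\<tau>. T y \<tau>) has_real_derivative Tyy y t) (at t)) \<and>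
      (\<forall>t>0. - Ty (S t) t = L t * deriv S t) \<and>
      (\<forall>t>0. T (S t) t = Tm t) \<and>
      (\<forall>t>0. Ty 0 t = - q))"

text \<open>
  The region of the problem for \<open>\<Psi>\<close>: the points between the two free boundaries, that is
  \<open>X\<^sub>0(t) < x < X\<^sub>1(t)\<close> in the case \<open>X\<^sub>0(t) < X\<^sub>1(t)\<close>.  The opposite orientation has to be admitted:
  if \<open>X\<^sub>0(0+) = 0\<close>, which the integral formula for \<open>X\<^sub>0\<close> entails, then condition (ii) and \<open>C(0) = 0\<close>
  force \<open>\<Psi>(X\<^sub>0(t),t) < 0\<close> for small \<open>t\<close>, so that \<open>y \<mapsto> x\<close> (whose derivative is \<open>1/\<Psi>\<close>) decreases.
\<close>
definition psi_strip :: "(real \<Rightarrow> real) \<Rightarrow> (real \<Rightarrow> real) \<Rightarrow> real \<Rightarrow> real set" where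
  "psi_strip X0 X1 t = closed_segment (X0 t) (X1 t)"

definition H_fun ::
  "real \<Rightarrow> (real \<Rightarrow> real) \<Rightarrow> (real \<Rightarrow> real) \<Rightarrow> (real \<Rightarrow> real) \<Rightarrow> (real \<Rightarrow> real \<Rightarrow> real) \<Rightarrow>
   (real \<Rightarrow> real) \<Rightarrow> (real \<Rightarrow> real) \<Rightarrow> real \<Rightarrow> real" where
  "H_fun \<delta> L Tm C \<Psi> X0 X1 t =
     - (Tm t ^ 3 / (L t * C t ^ 2)) + \<delta> * (Tm t / L t) * (1 / \<Psi> (X1 t) t)
     - \<delta> / \<Psi> (X1 t) t + Tm t ^ 2 / C t ^ 2 + \<delta> / \<Psi> (X0 t) t - \<delta>\<^sup>2 * X0 t ^ 2"

text \<open>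
  The bracket common to conditions (i) and (iii).
\<close>
definition outer_flux ::
  "real \<Rightarrow> (real \<Rightarrow> real \<Rightarrow> real) \<Rightarrow> (real \<Rightarrow> real) \<Rightarrow> (real \<Rightarrow> real) \<Rightarrow> real \<Rightarrow> real" where
  "outer_flux \<delta> \<Psi> X0 X1 t =
     \<Psi> (X1 t) t * deriv X1 t
     + dspace (psi_strip X0 X1) \<Psi> (X1 t) t / \<Psi> (X1 t) t ^ 2 + 2 * \<delta> * X1 t"

text \<open>
  The equation, conditions (i) and (iii) and the formula for \<open>X\<^sub>1\<close>: all parts of the problem for
  \<open>\<Psi>\<close> in which no integral from \<open>0\<close> to \<open>t\<close> occurs.
\<close>
definition psi_equations ::
  "real \<Rightarrow> (real \<Rightarrow> real) \<Rightarrow> (real \<Rightarrow> real) \<Rightarrow> (real \<Rightarrow> real) \<Rightarrow> (real \<Rightarrow> real \<Rightarrow> real) \<Rightarrow>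
   (real \<Rightarrow> real) \<Rightarrow> (real \<Rightarrow> real) \<Rightarrow> bool" where
  "psi_equations \<delta> L Tm C \<Psi> X0 X1 \<longleftrightarrow>
    (let D = psi_strip X0 X1; \<Psi>x = dspace D \<Psi> in
      \<comment> \<open>regularity and standing assumptions\<close>
      C 0 = 0 \<and> continuous_on {0..} C \<and> (\<forall>t>0. C t > 0) \<and>
      (\<forall>t>0. X0 t \<noteq> X1 t \<and> X0 differentiable (at t) \<and> X1 differentiable (at t)) \<and>
      (\<forall>t>0. (\<forall>x\<in>D t. \<Psi> x t \<noteq> 0) \<and> (\<lambda>z. \<Psi> z t) differentiable_on D t) \<and>
      continuous_on (region D) (\<lambda>(x, t). \<Psi> x t) \<and>
      continuous_on (region D) (\<lambda>(x, t). \<Psi>x x t) \<and>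
      \<comment> \<open>differential equation\<close>
      (\<forall>t>0. \<forall>x\<in>open_segment (X0 t) (X1 t). \<exists>F.
         ((\<lambda>z. \<Psi>x z t / \<Psi> z t ^ 2) has_real_derivative F) (at x) \<and>
         ((\<lambda>\<tau>. \<Psi> x \<tau>) has_real_derivative F + 2 * \<delta>) (at t)) \<and>
      \<comment> \<open>(i)\<close>
      (\<forall>t>0. 1 / \<Psi> (X1 t) t - \<delta> * X1 t ^ 2 = - (L t / (\<delta> * C t)) * outer_flux \<delta> \<Psi> X0 X1 t) \<and>
      \<comment> \<open>(iii)\<close>
      (\<forall>t>0. (C has_real_derivative (L t - Tm t) * outer_flux \<delta> \<Psi> X0 X1 t) (at t)) \<and>
      \<comment> \<open>outer free boundary\<close>
      (\<forall>t>0. X1 t = Tm t / (\<delta> * C t)))"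

text \<open>
  The two conditions at \<open>X\<^sub>0\<close> which contain a time integral, with initial time \<open>s\<close>, initial value
  \<open>a\<close> of \<open>X\<^sub>0\<close> and constant \<open>k\<close> in condition (ii).  The problem under consideration has
  \<open>s = 0\<close>, \<open>a = 0\<close>, \<open>k = q\<close>.  The Henstock-Kurzweil integral covers integrands which are only
  improperly integrable at \<open>s\<close>.
\<close>
definition inner_conditions_from ::
  "real \<Rightarrow> (real \<Rightarrow> real) \<Rightarrow> (real \<Rightarrow> real) \<Rightarrow> (real \<Rightarrow> real) \<Rightarrow> (real \<Rightarrow> real \<Rightarrow> real) \<Rightarrow>
   (real \<Rightarrow> real) \<Rightarrow> (real \<Rightarrow> real) \<Rightarrow> real \<Rightarrow> real \<Rightarrow> real \<Rightarrow> bool" where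
  "inner_conditions_from \<delta> L Tm C \<Psi> X0 X1 s a k \<longleftrightarrow>
    (let \<Psi>x = dspace (psi_strip X0 X1) \<Psi>;
         H = H_fun \<delta> L Tm C \<Psi> X0 X1;
         G = (\<lambda>\<tau>. \<Psi>x (X0 \<tau>) \<tau> / \<Psi> (X0 \<tau>) \<tau> ^ 3 + 2 * \<delta> * (X0 \<tau> / \<Psi> (X0 \<tau>) \<tau>)) in
      (\<forall>t>s. G integrable_on {s..t} \<and> X0 t = a - integral {s..t} G) \<and>
      \<comment> \<open>(ii)\<close>
      (\<forall>t>s. H integrable_on {s..t} \<and>
         1 / \<Psi> (X0 t) t - \<delta> * X0 t ^ 2 = - k * exp (integral {s..t} H) / (\<delta> * C t)))"

definition psi_problem ::
  "real \<Rightarrow> real \<Rightarrow> (real \<Rightarrow> real) \<Rightarrow> (real \<Rightarrow> real) \<Rightarrow> (real \<Rightarrow> real) \<Rightarrow> (real \<Rightarrow> real \<Rightarrow> real) \<Rightarrow>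
   (real \<Rightarrow> real) \<Rightarrow> (real \<Rightarrow> real) \<Rightarrow> bool" where
  "psi_problem \<delta> q L Tm C \<Psi> X0 X1 \<longleftrightarrow>
     psi_equations \<delta> L Tm C \<Psi> X0 X1 \<and> inner_conditions_from \<delta> L Tm C \<Psi> X0 X1 0 0 q"

end

theory Submission
  imports Defs
begin

text \<open>
  Put \<open>W(y,t) = C(t) - \<integral>\<^bsub>S(t)\<^esub>\<^bsup>y\<^esup> T(u,t) du\<close>.  Then \<open>W\<^sub>y = - T\<close>, and the Stefan condition together with the
  choice of \<open>C\<close> gives \<open>W\<^sub>t = - T\<^sub>y\<close>, so \<open>W\<close> solves the heat equation up to the lateral boundaries.
  By the Cole-Hopf transformation \<open>x = T/(\<delta> W)\<close> solves \<open>x\<^sub>t = x\<^sub>y\<^sub>y - 2 \<delta> x x\<^sub>y\<close>, and the parametric formula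
  says \<open>\<Psi>(x(y,t),t) = 1/x\<^sub>y(y,t)\<close>.  The equation for \<open>\<Psi>\<close> is the Burgers equation with \<open>x\<close> as independent
  variable.  At \<open>y = S(t)\<close> the bracket in (i) and (iii) becomes \<open>dS/dt\<close>; at \<open>y = 0\<close> the integrand
  in the formula for \<open>X\<^sub>0\<close> is \<open>- dX\<^sub>0/dt\<close>, and \<open>H\<close> is the logarithmic derivative of \<open>C(t)/W(0,t)\<close>.  Hence
  the two conditions with integrals from \<open>0\<close> hold exactly if \<open>X\<^sub>0\<close> and \<open>ln (C(t)/W(0,t))\<close> vanish at \<open>0+\<close>.
\<close>

subsection \<open>Functions of two real variables\<close>

text \<open>One partial is needed only at the point itself, because the other is jointly continuous.
  Derivatives are taken within a product set, so boundary points of a closed strip are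
  covered.\<close>

lemma has_derivative_of_partials:
  fixes u :: "real \<Rightarrow> real \<Rightarrow> real"
  assumes "((\<lambda>x. u x y) has_real_derivative p) (at x within X)"
    and "\<And>x y. x \<in> X \<Longrightarrow> y \<in> Y \<Longrightarrow> ((\<lambda>y. u x y) has_real_derivative r x y) (at y within Y)"
    and "continuous_on (X \<times> Y) (\<lambda>z. r (fst z) (snd z))"
    and "x \<in> X" "y \<in> Y" "convex Y"
  shows "((\<lambda>z. u (fst z) (snd z)) has_derivative (\<lambda>h. p * fst h + r x y * snd h))
           (at (x, y) within X \<times> Y)"
proof -
  have "((\<lambda>(x, y). u x y) has_derivative (\<lambda>(tx, ty). p * tx + blinfun_mult_right (r x y) ty))
      (at (x, y) within X \<times> Y)"
  proof (rule has_derivative_partialsI[where fy = "\<lambda>x y. blinfun_mult_right (r x y)"])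
    show "continuous (at (x, y) within X \<times> Y) (\<lambda>(x, y). blinfun_mult_right (r x y))"
      using assms(3-5) unfolding split_beta
      by (intro continuous_intros bounded_linear.continuous[OF bounded_linear_blinfun_mult_right])
        (auto simp: continuous_on_eq_continuous_within)
  qed (use assms in \<open>auto simp: has_field_derivative_def\<close>)
  then show ?thesis
    by (simp add: case_prod_beta')
qed

lemma has_derivative_of_partials_open:
  fixes u :: "real \<Rightarrow> real \<Rightarrow> real"
  assumes U: "open U" "(x, y) \<in> U"
    and p: "((\<lambda>x. u x y) has_real_derivative p) (at x)"
    and r: "\<And>x y. (x, y) \<in> U \<Longrightarrow> ((\<lambda>y. u x y) has_real_derivative r x y) (at y)"
    and cont: "continuous_on U (\<lambda>z. r (fst z) (snd z))"
  shows "((\<lambda>z. u (fst z) (snd z)) has_derivative (\<lambda>h. p * fst h + r x y * snd h)) (at (x, y))"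
proof -
  obtain A B where AB: "open A" "open B" "x \<in> A" "y \<in> B" "A \<times> B \<subseteq> U"
    using open_prod_elim[OF U] by (metis mem_Times_iff fst_conv snd_conv)
  obtain e where e: "e > 0" "ball y e \<subseteq> B"
    using AB openE by blast
  have sub: "A \<times> ball y e \<subseteq> U"
    using AB e by auto
  have "((\<lambda>z. u (fst z) (snd z)) has_derivative (\<lambda>h. p * fst h + r x y * snd h))
      (at (x, y) within A \<times> ball y e)"
  proof (rule has_derivative_of_partials)
    show "((\<lambda>x. u x y) has_real_derivative p) (at x within A)"
      using p by (rule has_field_derivative_at_within)
    show "((\<lambda>y. u x' y) has_real_derivative r x' y') (at y' within ball y e)"
      if "x' \<in> A" "y' \<in> ball y e" for x' y'
      using that sub by (intro has_field_derivative_at_within[OF r]) auto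
  qed (use AB e continuous_on_subset[OF cont sub] in auto)
  then show ?thesis
    using AB e by (subst (asm) at_within_open) (auto intro: open_Times)
qed

text \<open>Serves to carry differential equations from the open strip to its lateral boundaries.
  Integrating \<open>h c\<close> in time gives an identity whose two sides are continuous in
  \<open>c\<close>; it therefore persists at \<open>c = 0\<close> and \<open>c = 1\<close>, where
  the fundamental theorem differentiates it again.\<close>

lemma has_real_derivative_extend_param:
  fixes g h :: "real \<Rightarrow> real \<Rightarrow> real"
  assumes g: "continuous_on ({0..1} \<times> {0<..}) (\<lambda>z. g (fst z) (snd z))"
    and h: "continuous_on ({0..1} \<times> {0<..}) (\<lambda>z. h (fst z) (snd z))"
    and der: "\<And>c t. 0 < c \<Longrightarrow> c < 1 \<Longrightarrow> 0 < t \<Longrightarrow> ((\<lambda>t. g c t) has_real_derivative h c t) (at t)"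
    and c: "c \<in> {0..1}" and t: "t > 0"
  shows "((\<lambda>t. g c t) has_real_derivative h c t) (at t)"
proof -
  define a b where "a = t / 2" and "b = 2 * t"
  have ab: "0 < a" "a < t" "t < b"
    using t by (auto simp: a_def b_def)
  have gc: "continuous_on {0..1} (\<lambda>c. g c s)" if "s > 0" for s
    by (rule continuous_on_compose2[OF g, of _ "\<lambda>c. (c, s)", simplified])
      (auto intro!: continuous_intros simp: that)
  have hs: "continuous_on {a..b} (\<lambda>s. h c s)" if "c \<in> {0..1}" for c
    by (rule continuous_on_compose2[OF h, of _ "\<lambda>s. (c, s)", simplified])
      (use that ab in \<open>auto intro!: continuous_intros\<close>)
  have eq: "g c s = g c a + integral {a..s} (\<lambda>s. h c s)" if s: "s \<in> {a..b}" and c: "c \<in> {0..1}" for c s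
  proof -
    define G where "G c = g c s - (g c a + integral (cbox a s) (\<lambda>s. h c s))" for c
    have "continuous_on {0..1} (\<lambda>c. integral (cbox a s) (\<lambda>s. h c s))"
      by (rule integral_continuous_on_param, rule continuous_on_subset[OF h[folded split_beta]])
        (use ab in auto)
    then have contG: "continuous_on {0..1} G"
      unfolding G_def using s ab by (intro continuous_intros gc) auto
    have "G c = 0" if "c \<in> {0<..<1}" for c
    proof -
      have "((\<lambda>s. h c s) has_integral g c s - g c a) {a..s}"
      proof (rule fundamental_theorem_of_calculus)
        show "(g c has_vector_derivative h c x) (at x within {a..s})" if "x \<in> {a..s}" for x
          using der[of c x] that \<open>c \<in> {0<..<1}\<close> ab
          by (auto simp: has_real_derivative_iff_has_vector_derivative
              intro: has_vector_derivative_at_within)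
      qed (use s in auto)
      then show ?thesis
        by (simp add: G_def integral_unique)
    qed
    then have "G c = 0"
      using continuous_constant_on_closure[of "{0<..<1}" G 0 c] contG c by auto
    then show ?thesis
      by (simp add: G_def)
  qed
  have "((\<lambda>s. g c a + integral {a..s} (\<lambda>s. h c s)) has_real_derivative h c t) (at t within {a..b})"
    using integral_has_real_derivative[OF hs[OF c], of t] ab by (auto intro!: derivative_eq_intros)
  then have "((\<lambda>s. g c s) has_real_derivative h c t) (at t within {a..b})"
    unfolding has_field_derivative_def
    by (rule has_derivative_transform[rotated 2, OF _ _ eq[OF _ c]]) (use ab in simp_all)
  then show ?thesis
    using ab by (simp add: at_within_Icc_at)
qed

lemma has_real_derivative_joint_compose:
  fixes u :: "real \<Rightarrow> real \<Rightarrow> real"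
  assumes "((\<lambda>z. u (fst z) (snd z)) has_derivative (\<lambda>h. p * fst h + r * snd h)) (at (f t, g t))"
    and "(f has_real_derivative f') (at t within A)" "(g has_real_derivative g') (at t within A)"
  shows "((\<lambda>t. u (f t) (g t)) has_real_derivative p * f' + r * g') (at t within A)"
proof -
  have "((\<lambda>t. (f t, g t)) has_derivative (\<lambda>s. (f' * s, g' * s))) (at t within A)"
    using assms(2,3) unfolding has_field_derivative_def by (rule has_derivative_Pair)
  from has_derivative_compose[OF this assms(1)] show ?thesis
    unfolding has_field_derivative_def fst_conv snd_conv
    by (rule has_derivative_eq_rhs) (auto simp: algebra_simps)
qed

text \<open>Supplies the time derivative of \<open>Ty\<close>, taking \<open>u = T\<close>,
  \<open>r = Tyy\<close>, \<open>s = Tyyy\<close>. The time integral of \<open>r\<close> may be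
  differentiated in \<open>y\<close> under the integral sign, and the resulting formula for
  \<open>p\<close> is then differentiated in time.\<close>

lemma has_real_derivative_mixed_partial:
  fixes u p r s :: "real \<Rightarrow> real \<Rightarrow> real"
  assumes U: "open U" "(y, t) \<in> U"
    and p: "\<And>y t. (y, t) \<in> U \<Longrightarrow> ((\<lambda>y. u y t) has_real_derivative p y t) (at y)"
    and r: "\<And>y t. (y, t) \<in> U \<Longrightarrow> ((\<lambda>t. u y t) has_real_derivative r y t) (at t)"
    and s: "\<And>y t. (y, t) \<in> U \<Longrightarrow> ((\<lambda>y. r y t) has_real_derivative s y t) (at y)"
    and cont: "continuous_on U (\<lambda>z. s (fst z) (snd z))"
  shows "((\<lambda>t. p y t) has_real_derivative s y t) (at t)"
proof -
  obtain A B where AB: "open A" "open B" "y \<in> A" "t \<in> B" "A \<times> B \<subseteq> U"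
    using open_prod_elim[OF U] by (metis mem_Times_iff fst_conv snd_conv)
  obtain d where d: "d > 0" "ball y d \<subseteq> A"
    using AB openE by blast
  obtain e where e: "e > 0" "cball t e \<subseteq> B"
    using AB open_contains_cball by blast
  define a b where "a = t - e" and "b = t + e"
  have ab: "a < t" "t < b" "{a..b} = cball t e"
    using e by (auto simp: a_def b_def cball_eq_atLeastAtMost)
  have sub: "(z, \<tau>) \<in> U" if "z \<in> ball y d" "\<tau> \<in> {a..b}" for z \<tau>
    using that AB d e ab by blast
  have int: "((\<lambda>\<tau>. r z \<tau>) has_integral u z \<tau> - u z a) (cbox a \<tau>)" if "z \<in> ball y d" "\<tau> \<in> {a..b}" for z \<tau>
    unfolding cbox_interval
  proof (rule fundamental_theorem_of_calculus)
    show "((\<lambda>\<tau>. u z \<tau>) has_vector_derivative r z \<sigma>) (at \<sigma> within {a..\<tau>})" if "\<sigma> \<in> {a..\<tau>}" for \<sigma>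
      using r[OF sub, of z \<sigma>] that \<open>z \<in> ball y d\<close> \<open>\<tau> \<in> {a..b}\<close>
      by (simp add: has_real_derivative_iff_has_vector_derivative has_vector_derivative_at_within)
  qed (use that in auto)
  have eq: "p y \<tau> = p y a + integral {a..\<tau>} (\<lambda>\<tau>. s y \<tau>)" if \<tau>: "\<tau> \<in> {a..b}" for \<tau>
  proof -
    have "((\<lambda>z. integral (cbox a \<tau>) (r z)) has_real_derivative integral (cbox a \<tau>) (s y)) (at y within ball y d)"
    proof (rule leibniz_rule_field_derivative)
      show "((\<lambda>z. r z \<sigma>) has_real_derivative s z \<sigma>) (at z within ball y d)"
        if "z \<in> ball y d" "\<sigma> \<in> cbox a \<tau>" for z \<sigma>
        using that \<tau> by (intro has_field_derivative_at_within[OF s] sub) auto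
      show "continuous_on (ball y d \<times> cbox a \<tau>) (\<lambda>(z, \<tau>). s z \<tau>)"
        using cont unfolding split_beta by (rule continuous_on_subset) (use sub \<tau> in force)
    qed (use d int \<tau> in \<open>auto intro: has_integral_integrable\<close>)
    then have "((\<lambda>z. u z a + integral (cbox a \<tau>) (r z)) has_real_derivative p y a + integral (cbox a \<tau>) (s y)) (at y)"
      using p[OF sub, of y a] ab(1,2) d by (auto intro!: derivative_eq_intros simp: at_within_open[of y "ball y d"])
    then have "((\<lambda>z. u z \<tau>) has_real_derivative p y a + integral (cbox a \<tau>) (s y)) (at y)"
      by (rule has_field_derivative_transform_within_open[of _ _ _ "ball y d"])
        (use d integral_unique[OF int] \<tau> in auto)
    from DERIV_unique[OF this p[OF sub]] show ?thesis
      using d \<tau> by simp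
  qed
  have "continuous_on {a..b} (s y)"
    by (rule continuous_on_compose2[OF cont, of _ "\<lambda>t. (y, t)", simplified])
      (use sub d in \<open>auto intro!: continuous_intros\<close>)
  from integral_has_real_derivative[OF this, of t]
  have "((\<lambda>\<tau>. p y a + integral {a..\<tau>} (s y)) has_real_derivative s y t) (at t within {a..b})"
    using ab(1,2) by (auto intro!: derivative_eq_intros)
  then have "((\<lambda>\<tau>. p y \<tau>) has_real_derivative s y t) (at t within {a..b})"
    unfolding has_field_derivative_def
    by (rule has_derivative_transform[rotated 2, OF _ _ eq]) (use ab(1,2) in simp_all)
  then show ?thesis
    using ab(1,2) by (simp add: at_within_Icc_at)
qed

text \<open>Indefinite Henstock-Kurzweil integrals are continuous, which gives one direction. For
  the other, the fundamental theorem with derivatives at inner points yields integrability even when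
  \<open>f\<close> is unbounded near 0.\<close>

lemma tendsto_zero_iff_integral_of_derivative:
  fixes F :: "real \<Rightarrow> real"
  assumes der: "\<And>t. t > 0 \<Longrightarrow> (F has_real_derivative f t) (at t)"
  shows "(\<forall>t>0. f integrable_on {0..t} \<and> F t = integral {0..t} f) \<longleftrightarrow> (F \<longlongrightarrow> 0) (at_right 0)"
proof
  assume *: "\<forall>t>0. f integrable_on {0..t} \<and> F t = integral {0..t} f"
  have "continuous_on {0..1} (\<lambda>t. integral {0..t} f)"
    using * by (intro indefinite_integral_continuous_1) auto
  then have "((\<lambda>t. integral {0..t} f) \<longlongrightarrow> 0) (at 0 within {0..1})"
    by (drule_tac continuous_on_def[THEN iffD1, THEN bspec, of _ _ 0]) auto
  then have "((\<lambda>t. integral {0..t} f) \<longlongrightarrow> 0) (at_right 0)"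
    by (simp add: at_within_Icc_at_right)
  then show "(F \<longlongrightarrow> 0) (at_right 0)"
    by (rule Lim_transform_eventually) (use * in \<open>auto simp: eventually_at_right_less eventually_at_filter\<close>)
next
  assume lim: "(F \<longlongrightarrow> 0) (at_right 0)"
  \<comment> \<open>The hypotheses leave \<open>F 0\<close> free; \<open>F0\<close> takes the right
    limit there and is continuous on \<open>{0..t}\<close>.\<close>
  define F0 where "F0 t = (if t = 0 then 0 else F t)" for t
  have "(f has_integral F0 t - F0 0) {0..t}" if t: "t > 0" for t
  proof (rule fundamental_theorem_of_calculus_interior)
    show "(F0 has_vector_derivative f s) (at s)" if "s \<in> {0<..<t}" for s
      using der[of s] that unfolding has_real_derivative_iff_has_vector_derivative[symmetric]
      by (auto intro: has_field_derivative_transform_within_open[of F _ _ "{0<..}"] simp: F0_def)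
    show "continuous_on {0..t} F0"
      unfolding continuous_on_def
    proof
      fix s assume s: "s \<in> {0..t}"
      show "(F0 \<longlongrightarrow> F0 s) (at s within {0..t})"
      proof (cases "s = 0")
        case True
        have "(F0 \<longlongrightarrow> 0) (at_right 0)"
          using lim by (rule Lim_transform_eventually) (auto simp: eventually_at_filter F0_def)
        then show ?thesis
          using True t by (simp add: at_within_Icc_at_right F0_def)
      next
        case False
        then have "(F0 has_real_derivative f s) (at s)"
          using der[of s] s
          by (auto intro: has_field_derivative_transform_within_open[of F _ _ "{0<..}"] simp: F0_def)
        then show ?thesis
          using DERIV_isCont continuous_at_imp_continuous_within continuous_within by blast
      qed
    qed
  qed (use t in auto)
  then show "\<forall>t>0. f integrable_on {0..t} \<and> F t = integral {0..t} f"
    by (auto simp: F0_def intro: has_integral_integrable integral_unique[symmetric])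
qed

subsection \<open>Strips with a moving boundary\<close>

locale moving_strip =
  fixes S S' :: "real \<Rightarrow> real"
  assumes S_pos: "t > 0 \<Longrightarrow> S t > 0"
    and S_deriv: "t > 0 \<Longrightarrow> (S has_real_derivative S' t) (at t)"
    and S'_cont: "continuous_on {0<..} S'"
begin

abbreviation "\<Omega> \<equiv> region (stefan_strip S)"
abbreviation "\<Omega>i \<equiv> region (\<lambda>t. {0<..<S t})"

lemma mem_\<Omega>: "(y, t) \<in> \<Omega> \<longleftrightarrow> t > 0 \<and> 0 \<le> y \<and> y \<le> S t"
  by (auto simp: region_def stefan_strip_def)

lemma mem_\<Omega>i: "(y, t) \<in> \<Omega>i \<longleftrightarrow> t > 0 \<and> 0 < y \<and> y < S t"
  by (auto simp: region_def)

lemma \<Omega>i_subset: "\<Omega>i \<subseteq> \<Omega>"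
  by (auto simp: mem_\<Omega> mem_\<Omega>i)

lemma S_cont: "continuous_on {0<..} S"
  by (rule continuous_at_imp_continuous_on) (auto intro: DERIV_isCont S_deriv)

lemma open_\<Omega>i: "open \<Omega>i"
proof -
  have "open ((UNIV \<times> {0<..}) \<inter> (\<lambda>z. min (fst z) (S (snd z) - fst z)) -` {0<..})"
    by (intro continuous_open_preimage continuous_intros continuous_on_compose2[OF S_cont] open_Times) auto
  also have "\<dots> = \<Omega>i"
    by (auto simp: mem_\<Omega>i)
  finally show ?thesis .
qed

lemma scaled_mem_\<Omega>: "c \<in> {0..1} \<Longrightarrow> t > 0 \<Longrightarrow> (c * S t, t) \<in> \<Omega>"
  using S_pos[of t] by (auto simp: mem_\<Omega> mult_left_le_one_le)

lemma scaled_mem_\<Omega>i: "0 < c \<Longrightarrow> c < 1 \<Longrightarrow> t > 0 \<Longrightarrow> (c * S t, t) \<in> \<Omega>i"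
  using S_pos[of t] by (auto simp: mem_\<Omega>i)

lemma continuous_on_scaled:
  assumes "continuous_on \<Omega> (\<lambda>z. u (fst z) (snd z))"
  shows "continuous_on ({0..1} \<times> {0<..}) (\<lambda>z. u (fst z * S (snd z)) (snd z))"
  by (rule continuous_on_compose2[OF assms, of _ "\<lambda>z. (fst z * S (snd z), snd z)", simplified])
    (auto intro!: continuous_intros continuous_on_compose2[OF S_cont] scaled_mem_\<Omega>)

lemma continuous_on_scaled_line:
  assumes "continuous_on \<Omega> (\<lambda>z. u (fst z) (snd z))" "c \<in> {0..1}"
  shows "continuous_on {0<..} (\<lambda>t. u (c * S t) t)"
  by (rule continuous_on_compose2[OF continuous_on_scaled[OF assms(1)], of _ "\<lambda>t. (c, t)", simplified])
    (use assms(2) in \<open>auto intro!: continuous_intros\<close>)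

lemma continuous_on_unscaled:
  fixes w :: "real \<Rightarrow> real \<Rightarrow> real"
  assumes "continuous_on ({0..1} \<times> {0<..}) (\<lambda>z. w (fst z) (snd z))"
  shows "continuous_on \<Omega> (\<lambda>z. w (fst z / S (snd z)) (snd z))"
  by (rule continuous_on_compose2[OF assms, of _ "\<lambda>z. (fst z / S (snd z), snd z)", simplified])
    (use S_pos in \<open>force intro!: continuous_intros continuous_on_compose2[OF S_cont] simp: mem_\<Omega>\<close>)+

text \<open>For \<open>0 < c < 1\<close> the curve \<open>y = c * S t\<close> runs inside the strip
  and the chain rule applies; the boundary curves \<open>c = 0\<close> and \<open>c = 1\<close>
  follow by continuity in \<open>c\<close>.\<close>

lemma has_derivative_scaled_line:
  fixes u p r :: "real \<Rightarrow> real \<Rightarrow> real"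
  assumes u: "continuous_on \<Omega> (\<lambda>z. u (fst z) (snd z))"
    and p: "continuous_on \<Omega> (\<lambda>z. p (fst z) (snd z))"
    and r: "continuous_on \<Omega> (\<lambda>z. r (fst z) (snd z))"
    and der: "\<And>y t. (y, t) \<in> \<Omega>i \<Longrightarrow>
      ((\<lambda>z. u (fst z) (snd z)) has_derivative (\<lambda>h. p y t * fst h + r y t * snd h)) (at (y, t))"
    and c: "c \<in> {0..1}" and t: "t > 0"
  shows "((\<lambda>t. u (c * S t) t) has_real_derivative c * S' t * p (c * S t) t + r (c * S t) t) (at t)"
proof (rule has_real_derivative_extend_param[OF _ _ _ c t])
  show "continuous_on ({0..1} \<times> {0<..}) (\<lambda>z. u (fst z * S (snd z)) (snd z))"
    by (rule continuous_on_scaled[OF u])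
  show "continuous_on ({0..1} \<times> {0<..}) (\<lambda>z. fst z * S' (snd z) * p (fst z * S (snd z)) (snd z)
      + r (fst z * S (snd z)) (snd z))"
    by (intro continuous_intros continuous_on_scaled[OF p] continuous_on_scaled[OF r]
      continuous_on_compose2[OF S'_cont]) auto
  show "((\<lambda>t. u (c * S t) t) has_real_derivative c * S' t * p (c * S t) t + r (c * S t) t) (at t)"
    if "0 < c" "c < 1" "0 < t" for c t
  proof -
    have "((\<lambda>t. c * S t) has_real_derivative c * S' t) (at t)"
      using S_deriv[of t] that by (auto intro!: derivative_eq_intros)
    from has_real_derivative_joint_compose[OF der[OF scaled_mem_\<Omega>i[OF that]] this DERIV_ident]
    show ?thesis
      by (simp add: mult.commute)
  qed
qed

lemma at_within_interior_strip: "(y, t) \<in> \<Omega>i \<Longrightarrow> at y within {0..S t} = at y"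
  by (auto simp: mem_\<Omega>i at_within_Icc_at)

lemma continuous_on_slice:
  assumes "continuous_on \<Omega> (\<lambda>z. u (fst z) (snd z))" "t > 0"
  shows "continuous_on {0..S t} (\<lambda>y. u y t)"
  by (rule continuous_on_compose2[OF assms(1), of _ "\<lambda>y. (y, t)", simplified])
    (use assms(2) in \<open>auto intro!: continuous_intros simp: mem_\<Omega>\<close>)

text \<open>
  Differentiation under the integral sign is carried out in the coordinate \<open>c = y / S t\<close>, where the
  strip has a fixed width and the end points need no special treatment.
\<close>
lemma heat_potential:
  fixes T Ty Tyy W :: "real \<Rightarrow> real \<Rightarrow> real" and C C' :: "real \<Rightarrow> real"
  assumes T: "continuous_on \<Omega> (\<lambda>z. T (fst z) (snd z))"
    and Ty: "continuous_on \<Omega> (\<lambda>z. Ty (fst z) (snd z))"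
    and Tyy: "continuous_on \<Omega> (\<lambda>z. Tyy (fst z) (snd z))"
    and T_y: "\<And>y t. (y, t) \<in> \<Omega> \<Longrightarrow> ((\<lambda>y. T y t) has_real_derivative Ty y t) (at y within {0..S t})"
    and Ty_y: "\<And>y t. (y, t) \<in> \<Omega> \<Longrightarrow> ((\<lambda>y. Ty y t) has_real_derivative Tyy y t) (at y within {0..S t})"
    and T_diff: "\<And>y t. (y, t) \<in> \<Omega>i \<Longrightarrow>
      ((\<lambda>z. T (fst z) (snd z)) has_derivative (\<lambda>h. Ty y t * fst h + Tyy y t * snd h)) (at (y, t))"
    and C: "\<And>t. t > 0 \<Longrightarrow> (C has_real_derivative C' t) (at t)"
    and C': "\<And>t. t > 0 \<Longrightarrow> C' t = - (S' t * T (S t) t) - Ty (S t) t"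
    and W: "\<And>y t. (y, t) \<in> \<Omega> \<Longrightarrow> W y t = C t + integral {y..S t} (\<lambda>u. T u t)"
  shows heat_potential_y:
      "\<And>y t. (y, t) \<in> \<Omega> \<Longrightarrow> ((\<lambda>y. W y t) has_real_derivative - T y t) (at y within {0..S t})"
    and heat_potential_line: "\<And>c t. c \<in> {0..1} \<Longrightarrow> t > 0 \<Longrightarrow>
      ((\<lambda>t. W (c * S t) t) has_real_derivative - (c * S' t * T (c * S t) t) - Ty (c * S t) t) (at t)"
    and heat_potential_continuous: "continuous_on \<Omega> (\<lambda>z. W (fst z) (snd z))"
    and heat_potential_has_derivative: "\<And>y t. (y, t) \<in> \<Omega>i \<Longrightarrow>
      ((\<lambda>z. W (fst z) (snd z)) has_derivative (\<lambda>h. - T y t * fst h + - Ty y t * snd h)) (at (y, t))"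
proof -
  show W_y: "((\<lambda>y. W y t) has_real_derivative - T y t) (at y within {0..S t})" if yt: "(y, t) \<in> \<Omega>" for y t
  proof -
    have t: "t > 0" and y: "y \<in> {0..S t}"
      using yt by (auto simp: mem_\<Omega>)
    have cont: "continuous_on {0..S t} (\<lambda>u. T u t)"
      by (rule continuous_on_slice[OF T t])
    have int: "(\<lambda>u. T u t) integrable_on {0..S t}"
      by (rule integrable_continuous_real[OF cont])
    have eq: "W y t = C t + integral {0..S t} (\<lambda>u. T u t) - integral {0..y} (\<lambda>u. T u t)" if "y \<in> {0..S t}" for y
      using Henstock_Kurzweil_Integration.integral_combine[OF _ _ int, of y] that t
      by (simp add: W mem_\<Omega>)
    have "((\<lambda>y. C t + integral {0..S t} (\<lambda>u. T u t) - integral {0..y} (\<lambda>u. T u t))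
        has_real_derivative - T y t) (at y within {0..S t})"
      using integral_has_real_derivative[OF cont y] by (auto intro!: derivative_eq_intros)
    then show ?thesis
      unfolding has_field_derivative_def
      by (rule has_derivative_transform[rotated 2, OF _ y eq]) simp_all
  qed
  have line_y: "((\<lambda>c. u (c * S t) t) has_real_derivative v (c * S t) t * S t) (at c within {0..1})"
    if "\<And>y t. (y, t) \<in> \<Omega> \<Longrightarrow> ((\<lambda>y. u y t) has_real_derivative v y t) (at y within {0..S t})"
      "c \<in> {0..1}" "t > 0" for u v :: "real \<Rightarrow> real \<Rightarrow> real" and c t
  proof -
    have "((\<lambda>c. c * S t) has_real_derivative S t) (at c within {0..1})"
      by (auto intro!: derivative_eq_intros)
    moreover have "((\<lambda>y. u y t) has_real_derivative v (c * S t) t)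
        (at (c * S t) within (\<lambda>c. c * S t) ` {0..1})"
      using that(1)[OF scaled_mem_\<Omega>[OF that(2,3)]]
      by (rule DERIV_subset) (use scaled_mem_\<Omega> that in \<open>auto simp: mem_\<Omega>\<close>)
    ultimately show ?thesis
      using DERIV_image_chain[of "\<lambda>y. u y t" _ "\<lambda>c. c * S t"] by (auto simp: o_def)
  qed
  have Ww_c: "((\<lambda>c. W (c * S t) t) has_real_derivative - (S t * T (c * S t) t)) (at c within {0..1})"
    if "c \<in> {0..1}" "t > 0" for c t
    using line_y[OF W_y that] by (simp add: mult.commute)
  \<comment> \<open>The interval of integration no longer depends on \<open>t\<close>; the moving
    end enters only through the integrand.\<close>
  have W_eq: "W (c * S t) t = C t + integral {c..1} (\<lambda>c. S t * T (c * S t) t)"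
    if "c \<in> {0..1}" "t > 0" for c t
  proof -
    have "((\<lambda>c. - T (c * S t) t * S t) has_integral W (1 * S t) t - W (c * S t) t) {c..1}"
    proof (rule fundamental_theorem_of_calculus)
      show "((\<lambda>c. W (c * S t) t) has_vector_derivative - T (d * S t) t * S t) (at d within {c..1})"
        if "d \<in> {c..1}" for d
        using line_y[OF W_y, of d t] that \<open>c \<in> {0..1}\<close> \<open>t > 0\<close>
        by (auto simp flip: has_real_derivative_iff_has_vector_derivative intro: DERIV_subset)
    qed (use that in auto)
    then have "((\<lambda>c. S t * T (c * S t) t) has_integral W (c * S t) t - W (1 * S t) t) {c..1}"
      by (drule_tac has_integral_neg) (simp add: mult.commute)
    from integral_unique[OF this] show ?thesis
      using S_pos[of t] that by (simp add: W mem_\<Omega>)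
  qed
  show W_line: "((\<lambda>t. W (c * S t) t) has_real_derivative
      - (c * S' t * T (c * S t) t) - Ty (c * S t) t) (at t)" if c: "c \<in> {0..1}" and t: "t > 0" for c t
  proof -
    define f where "f t c = S t * T (c * S t) t" for t c
    define f' where "f' t c = S' t * T (c * S t) t + S t * (c * S' t * Ty (c * S t) t + Tyy (c * S t) t)" for t c
    have cont: "continuous_on ({0<..} \<times> {0..1}) (\<lambda>z. u (snd z * S (fst z)) (fst z))"
      if "continuous_on \<Omega> (\<lambda>z. u (fst z) (snd z))" for u :: "real \<Rightarrow> real \<Rightarrow> real"
      by (rule continuous_on_compose2[OF continuous_on_scaled[OF that], of _ "\<lambda>z. (snd z, fst z)", simplified])
        (auto intro!: continuous_intros)
    have cont_f': "continuous_on ({0<..} \<times> {0..1}) (\<lambda>z. f' (fst z) (snd z))"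
      unfolding f'_def by (intro continuous_intros cont T Ty Tyy continuous_on_compose2[OF S'_cont]
          continuous_on_compose2[OF S_cont]) auto
    have der_f: "((\<lambda>t. f t c) has_real_derivative f' t c) (at t)" if "t > 0" "c \<in> {0..1}" for t c
      unfolding f_def f'_def
      using S_deriv[of t] has_derivative_scaled_line[OF T Ty Tyy T_diff, of c t] that
      by (auto intro!: derivative_eq_intros)
    have "((\<lambda>t. integral (cbox c 1) (f t)) has_real_derivative integral (cbox c 1) (f' t)) (at t within {0<..})"
    proof (rule leibniz_rule_field_derivative)
      show "((\<lambda>t. f t d) has_real_derivative f' t d) (at t within {0<..})"
        if "t \<in> {0<..}" "d \<in> cbox c 1" for t d
        using der_f[of t d] that c by (auto intro: has_field_derivative_at_within)
      show "f t integrable_on cbox c 1" if "t \<in> {0<..}" for t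
      proof -
        have "continuous_on {0..1} (\<lambda>c. T (c * S t) t)"
          using line_y[OF T_y, of _ t] that by (intro DERIV_continuous_on) auto
        then have "continuous_on (cbox c 1) (f t)"
          unfolding f_def using c by (intro continuous_intros) (auto elim: continuous_on_subset)
        then show ?thesis
          by (rule integrable_continuous)
      qed
      show "continuous_on ({0<..} \<times> cbox c 1) (\<lambda>(x, t). f' x t)"
        using cont_f' unfolding split_beta by (rule continuous_on_subset) (use c in auto)
    qed (use t in auto)
    \<comment> \<open>\<open>f' t\<close> is an exact derivative in \<open>c\<close>. The boundary
      value at \<open>c = 1\<close> is \<open>S' t * T (S t) t + Ty (S t) t = - C' t\<close>, which
      cancels against the derivative of \<open>C\<close>.\<close>
    moreover have "(f' t has_integral (1 * S' t * T (1 * S t) t + Ty (1 * S t) t)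
        - (c * S' t * T (c * S t) t + Ty (c * S t) t)) {c..1}"
    proof (rule fundamental_theorem_of_calculus)
      show "((\<lambda>c. c * S' t * T (c * S t) t + Ty (c * S t) t) has_vector_derivative f' t d) (at d within {c..1})"
        if "d \<in> {c..1}" for d
      proof -
        have "((\<lambda>c. c * S' t * T (c * S t) t + Ty (c * S t) t) has_real_derivative f' t d) (at d within {0..1})"
          using line_y[OF T_y, of d t] line_y[OF Ty_y, of d t] that c t
          unfolding f'_def by (auto intro!: derivative_eq_intros simp: algebra_simps)
        then show ?thesis
          unfolding has_real_derivative_iff_has_vector_derivative[symmetric]
          by (rule DERIV_subset) (use c in auto)
      qed
    qed (use c in auto)
    ultimately have "((\<lambda>t. C t + integral {c..1} (f t)) has_real_derivative
        - (c * S' t * T (c * S t) t) - Ty (c * S t) t) (at t)"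
      using C[OF t] C'[OF t] t
      by (auto intro!: derivative_eq_intros simp: at_within_open[of t "{0<..}"] integral_unique)
    then show ?thesis
      by (rule has_field_derivative_transform_within_open[of _ _ _ "{0<..}"])
        (use t c in \<open>auto simp: W_eq f_def[abs_def]\<close>)
  qed
  \<comment> \<open>Joint differentiability up to \<open>c = 0\<close> and \<open>c = 1\<close>; it
    gives both the continuity of \<open>W\<close> on the closed strip and its time derivative at
    fixed \<open>y\<close> inside.\<close>
  have Ww: "((\<lambda>z. W (fst z * S (snd z)) (snd z)) has_derivative
      (\<lambda>h. - (S t * T (c * S t) t) * fst h + (- (c * S' t * T (c * S t) t) - Ty (c * S t) t) * snd h))
      (at (c, t) within {0..1} \<times> {0<..})" if "c \<in> {0..1}" "t > 0" for c t
  proof (rule has_derivative_of_partials)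
    show "continuous_on ({0..1} \<times> {0<..})
        (\<lambda>z. - (fst z * S' (snd z) * T (fst z * S (snd z)) (snd z)) - Ty (fst z * S (snd z)) (snd z))"
      by (intro continuous_intros continuous_on_scaled T Ty continuous_on_compose2[OF S'_cont]) auto
  qed (use that Ww_c W_line in \<open>auto intro: has_field_derivative_at_within\<close>)
  have "continuous_on ({0..1} \<times> {0<..}) (\<lambda>z. W (fst z * S (snd z)) (snd z))"
    unfolding continuous_on_eq_continuous_within using Ww has_derivative_continuous by fastforce
  from continuous_on_unscaled[OF this]
  show "continuous_on \<Omega> (\<lambda>z. W (fst z) (snd z))"
    by (rule continuous_on_eq) (use S_pos in \<open>force simp: mem_\<Omega>\<close>)
  \<comment> \<open>A fixed \<open>y\<close> is the curve \<open>c = y / S t\<close> in scaled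
    coordinates; the motion of \<open>c\<close> contributes exactly the opposite of the term with
    \<open>S' t\<close>.\<close>
  have W_t: "((\<lambda>t. W y t) has_real_derivative - Ty y t) (at t)" if yt: "(y, t) \<in> \<Omega>i" for y t
  proof -
    have t: "t > 0" and y: "0 < y" "y < S t"
      using yt by (auto simp: mem_\<Omega>i)
    have within: "at (y / S t, t) within {0..1} \<times> {0<..} = at (y / S t, t)"
      using t y by (intro at_within_interior) (auto simp: interior_Times interior_open)
    have "((\<lambda>t. y / S t) has_real_derivative - (y * S' t / (S t)\<^sup>2)) (at t)"
      using S_deriv[OF t] S_pos[OF t] by (auto intro!: derivative_eq_intros simp: power2_eq_square)
    from has_real_derivative_joint_compose[OF Ww[of "y / S t" t, unfolded within] this DERIV_ident]
    have "((\<lambda>t. W (y / S t * S t) t) has_real_derivative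
        - (S t * T (y / S t * S t) t) * - (y * S' t / (S t)\<^sup>2) +
        (- (y / S t * S' t * T (y / S t * S t) t) - Ty (y / S t * S t) t) * 1) (at t)"
      using t y by auto
    moreover have "- (S t * T (y / S t * S t) t) * - (y * S' t / (S t)\<^sup>2) +
        (- (y / S t * S' t * T (y / S t * S t) t) - Ty (y / S t * S t) t) * 1 = - Ty y t"
      using S_pos[OF t] by (simp add: field_simps power2_eq_square)
    ultimately have "((\<lambda>t. W (y / S t * S t) t) has_real_derivative - Ty y t) (at t)"
      by (rule DERIV_cong)
    then show ?thesis
      by (rule has_field_derivative_transform_within_open[of _ _ _ "{0<..}"]) (use S_pos t in force)+
  qed
  show "((\<lambda>z. W (fst z) (snd z)) has_derivative (\<lambda>h. - T y t * fst h + - Ty y t * snd h)) (at (y, t))"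
    if yt: "(y, t) \<in> \<Omega>i" for y t
  proof (rule has_derivative_of_partials_open[OF open_\<Omega>i yt])
    show "((\<lambda>y. W y t) has_real_derivative - T y t) (at y)"
      using W_y[of y t] yt \<Omega>i_subset at_within_interior_strip by auto
    show "continuous_on \<Omega>i (\<lambda>z. - Ty (fst z) (snd z))"
      by (intro continuous_intros continuous_on_subset[OF Ty \<Omega>i_subset])
  qed (rule W_t)
qed

end

subsection \<open>The reciprocal transformation of the Burgers equation\<close>

text \<open>\<open>p\<close>, \<open>p'\<close>, \<open>p''\<close> are the first three
  y-derivatives of \<open>x\<close>, the third in the open strip only. The time coefficients of the
  two joint derivatives express the Burgers equation \<open>x_t = x_yy - 2 \<delta> x x_y\<close>
  and its y-derivative.\<close>

locale burgers_strip = moving_strip S S' for S S' :: "real \<Rightarrow> real" +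
  fixes \<delta> :: real and x p p' p'' :: "real \<Rightarrow> real \<Rightarrow> real" and X0 X1 :: "real \<Rightarrow> real"
  assumes x_cont: "continuous_on \<Omega> (\<lambda>z. x (fst z) (snd z))"
    and p_cont: "continuous_on \<Omega> (\<lambda>z. p (fst z) (snd z))"
    and p'_cont: "continuous_on \<Omega> (\<lambda>z. p' (fst z) (snd z))"
    and p_nonzero: "(y, t) \<in> \<Omega> \<Longrightarrow> p y t \<noteq> 0"
    and x_y: "(y, t) \<in> \<Omega> \<Longrightarrow> ((\<lambda>y. x y t) has_real_derivative p y t) (at y within {0..S t})"
    and p_y: "(y, t) \<in> \<Omega> \<Longrightarrow> ((\<lambda>y. p y t) has_real_derivative p' y t) (at y within {0..S t})"
    and p'_y: "(y, t) \<in> \<Omega>i \<Longrightarrow> ((\<lambda>y. p' y t) has_real_derivative p'' y t) (at y)"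
    and x_has_derivative: "(y, t) \<in> \<Omega>i \<Longrightarrow>
      ((\<lambda>z. x (fst z) (snd z)) has_derivative
        (\<lambda>h. p y t * fst h + (p' y t - 2 * \<delta> * x y t * p y t) * snd h)) (at (y, t))"
    and p_has_derivative: "(y, t) \<in> \<Omega>i \<Longrightarrow>
      ((\<lambda>z. p (fst z) (snd z)) has_derivative
        (\<lambda>h. p' y t * fst h + (p'' y t - 2 * \<delta> * ((p y t)\<^sup>2 + x y t * p' y t)) * snd h)) (at (y, t))"
    and X0: "t > 0 \<Longrightarrow> X0 t = x 0 t"
    and X1: "t > 0 \<Longrightarrow> X1 t = x (S t) t"
begin

text \<open>Mean value theorem with \<open>p\<close> nonzero. No sign of \<open>p\<close> is chosen,
  so both orientations of the strip are covered.\<close>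

lemma inj_on_x:
  assumes t: "t > 0"
  shows "inj_on (\<lambda>y. x y t) {0..S t}"
proof (rule linorder_inj_onI)
  fix a b assume ab: "a < b" "a \<in> {0..S t}" "b \<in> {0..S t}"
  have "continuous_on {a..b} (\<lambda>y. x y t)"
    by (rule continuous_on_subset[OF continuous_on_slice[OF x_cont t]]) (use ab in auto)
  moreover have "((\<lambda>y. x y t) has_derivative (*) (p z t)) (at z)" if "a < z" "z < b" for z
    using x_y[of z t] at_within_interior_strip[of z t] that ab t
    by (simp add: mem_\<Omega> mem_\<Omega>i has_field_derivative_def)
  ultimately obtain z where "a < z" "z < b" "x b t - x a t = p z t * (b - a)"
    using mvt[OF ab(1), of "\<lambda>y. x y t" "\<lambda>z. (*) (p z t)"] by auto
  then show "x a t \<noteq> x b t"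
    using p_nonzero[of z t] ab t by (auto simp: mem_\<Omega>)
qed auto

lemma image_x: "t > 0 \<Longrightarrow> (\<lambda>y. x y t) ` {0..S t} = closed_segment (X0 t) (X1 t)"
  using continuous_injective_image_segment_1[of 0 "S t" "\<lambda>y. x y t"]
    continuous_on_slice[OF x_cont] inj_on_x S_pos[of t]
  by (simp add: X0 X1 closed_segment_eq_real_ivl)

lemma image_x_interior: "t > 0 \<Longrightarrow> (\<lambda>y. x y t) ` {0<..<S t} = open_segment (X0 t) (X1 t)"
  using continuous_injective_image_open_segment_1[of 0 "S t" "\<lambda>y. x y t"]
    continuous_on_slice[OF x_cont] inj_on_x S_pos[of t]
  by (simp add: X0 X1 closed_segment_eq_real_ivl open_segment_eq_real_ivl)

lemma bij_betw_x: "t > 0 \<Longrightarrow> bij_betw (\<lambda>y. x y t) {0..S t} (closed_segment (X0 t) (X1 t))"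
  by (simp add: bij_betw_def inj_on_x image_x)

lemma X0_neq_X1: "t > 0 \<Longrightarrow> X0 t \<noteq> X1 t"
  using inj_onD[OF inj_on_x, of t 0 "S t"] S_pos[of t] by (auto simp: X0 X1)

abbreviation "\<Xi> \<equiv> region (psi_strip X0 X1)"

section \<open>The inverse of the space map at fixed time\<close>

definition \<eta> :: "real \<Rightarrow> real \<Rightarrow> real" where
  "\<eta> z t = the_inv_into {0..S t} (\<lambda>y. x y t) z"

lemma \<eta>_x: "(y, t) \<in> \<Omega> \<Longrightarrow> \<eta> (x y t) t = y"
  by (auto simp: \<eta>_def mem_\<Omega> intro!: the_inv_into_f_f inj_on_x)

lemma \<Xi>_eq: "\<Xi> = (\<lambda>(y, t). (x y t, t)) ` \<Omega>"
proof -
  have "\<Xi> = {(z, t). t > 0 \<and> z \<in> (\<lambda>y. x y t) ` {0..S t}}"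
    by (auto simp: region_def psi_strip_def simp flip: image_x)
  also have "\<dots> = (\<lambda>(y, t). (x y t, t)) ` \<Omega>"
    by (force simp: mem_\<Omega>)
  finally show ?thesis .
qed

lemma \<Xi>E:
  assumes "(z, t) \<in> \<Xi>"
  obtains y where "(y, t) \<in> \<Omega>" "z = x y t"
  using assms unfolding \<Xi>_eq by auto

lemma \<eta>_mem_\<Omega>: "(z, t) \<in> \<Xi> \<Longrightarrow> (\<eta> z t, t) \<in> \<Omega>"
  by (metis \<Xi>E \<eta>_x)

text \<open>A continuous injection on a compact set has a continuous inverse. This is applied to
  \<open>(y, t) -> (x y t, t)\<close> over a compact time window around the given time, which
  suffices since continuity is local.\<close>

lemma \<eta>_continuous: "continuous_on \<Xi> (\<lambda>z. \<eta> (fst z) (snd z))"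
  unfolding continuous_on_eq_continuous_within
proof
  fix w assume w: "w \<in> \<Xi>"
  define t a b where "t = snd w" and "a = t / 2" and "b = 2 * t"
  have t: "t > 0"
    using w by (auto simp: t_def region_def)
  have ab: "0 < a" "a < t" "t < b"
    using t by (auto simp: a_def b_def)
  \<comment> \<open>The part of the closed strip over \<open>{a..b}\<close>, written as the image of
    a rectangle so that it is compact.\<close>
  define K where "K = (\<lambda>z. (fst z * S (snd z), snd z)) ` ({0..1} \<times> {a..b})"
  have "continuous_on ({0..1} \<times> {a..b}) (\<lambda>z. (fst z * S (snd z), snd z))"
    by (intro continuous_intros continuous_on_compose2[OF S_cont]) (use ab in auto)
  then have K: "compact K"
    unfolding K_def by (rule compact_continuous_image) (intro compact_Times compact_Icc)
  have K_sub: "K \<subseteq> \<Omega>"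
    using scaled_mem_\<Omega> ab by (auto simp: K_def)
  have K_sup: "\<Omega> \<inter> (UNIV \<times> {a..b}) \<subseteq> K"
  proof clarsimp
    fix y s assume "(y, s) \<in> \<Omega>" and s: "a \<le> s" "s \<le> b"
    then have "(y / S s, s) \<in> {0..1} \<times> {a..b}" "(y, s) = (y / S s * S s, s)"
      using S_pos[of s] by (auto simp: mem_\<Omega>)
    then show "(y, s) \<in> K"
      unfolding K_def by force
  qed
  define \<Phi> where "\<Phi> z = (x (fst z) (snd z), snd z)" for z
  have "continuous_on (\<Phi> ` K) (\<lambda>z. (\<eta> (fst z) (snd z), snd z))"
  proof (rule continuous_on_inv[OF _ K])
    show "continuous_on K \<Phi>"
      unfolding \<Phi>_def by (intro continuous_intros continuous_on_subset[OF x_cont K_sub])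
  qed (use K_sub in \<open>auto simp: \<Phi>_def \<eta>_x\<close>)
  then have cont: "continuous_on (\<Phi> ` K) (\<lambda>z. \<eta> (fst z) (snd z))"
    by (auto dest: continuous_on_fst)
  have sub: "\<Xi> \<inter> (UNIV \<times> {a<..<b}) \<subseteq> \<Phi> ` K"
    using K_sup by (force simp: \<Xi>_eq \<Phi>_def)
  have "continuous (at w within \<Xi> \<inter> (UNIV \<times> {a<..<b})) (\<lambda>z. \<eta> (fst z) (snd z))"
    using continuous_on_subset[OF cont sub] w ab
    by (auto simp: continuous_on_eq_continuous_within t_def mem_Times_iff)
  moreover have "at w within \<Xi> \<inter> (UNIV \<times> {a<..<b}) = at w within \<Xi>"
    by (rule at_within_nhd[of _ "UNIV \<times> {a<..<b}"])
      (use ab in \<open>auto simp: t_def mem_Times_iff intro!: open_Times\<close>)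
  ultimately show "continuous (at w within \<Xi>) (\<lambda>z. \<eta> (fst z) (snd z))"
    by simp
qed

lemma continuous_on_\<Xi>:
  assumes "continuous_on \<Omega> (\<lambda>z. u (fst z) (snd z))"
  shows "continuous_on \<Xi> (\<lambda>z. u (\<eta> (fst z) (snd z)) (snd z))"
  by (rule continuous_on_compose2[OF assms, of _ "\<lambda>z. (\<eta> (fst z) (snd z), snd z)", simplified])
    (auto intro!: continuous_intros \<eta>_continuous \<eta>_mem_\<Omega>)

text \<open>Taken within the closed segment, so that the end points get one-sided derivatives; the
  rule for inverse functions rests on the continuity of \<open>\<eta>\<close>.\<close>

lemma \<eta>_deriv:
  assumes yt: "(y, t) \<in> \<Omega>"
  shows "((\<lambda>z. \<eta> z t) has_real_derivative 1 / p y t) (at (x y t) within psi_strip X0 X1 t)"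
proof -
  have t: "t > 0" and y: "y \<in> {0..S t}"
    using yt by (auto simp: mem_\<Omega>)
  have img: "psi_strip X0 X1 t = (\<lambda>y. x y t) ` {0..S t}"
    by (simp add: psi_strip_def image_x t)
  have "continuous_on ((\<lambda>y. x y t) ` {0..S t}) (\<lambda>z. \<eta> z t)"
    by (rule continuous_on_compose2[OF \<eta>_continuous, of _ "\<lambda>z. (z, t)", simplified])
      (use t img in \<open>auto intro!: continuous_intros simp: region_def\<close>)
  then have "continuous (at (x y t) within (\<lambda>y. x y t) ` {0..S t}) (\<lambda>z. \<eta> z t)"
    using y by (auto simp: continuous_on_eq_continuous_within)
  then have "((\<lambda>z. \<eta> z t) has_derivative (*) (1 / p y t)) (at (x y t) within (\<lambda>y. x y t) ` {0..S t})"
    using x_y[OF yt] y t p_nonzero[OF yt] unfolding has_field_derivative_def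
    by (intro has_derivative_inverse_within[where f = "\<lambda>y. x y t" and f' = "(*) (p y t)"])
      (auto simp: \<eta>_x mem_\<Omega> fun_eq_iff intro: linear_times)
  then show ?thesis
    by (simp add: has_field_derivative_def img)
qed

text \<open>The rule \<open>d/dx = (1/p) d/dy\<close>, by which all space derivatives of
  \<open>\<Psi>\<close> are computed below.\<close>

lemma deriv_along_\<eta>:
  assumes "(y, t) \<in> \<Omega>" "((\<lambda>y. u y t) has_real_derivative v) (at y within {0..S t})"
  shows "((\<lambda>z. u (\<eta> z t) t) has_real_derivative v / p y t) (at (x y t) within psi_strip X0 X1 t)"
proof -
  have t: "t > 0"
    using assms by (simp add: mem_\<Omega>)
  have "(\<lambda>z. \<eta> z t) ` psi_strip X0 X1 t \<subseteq> {0..S t}"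
    using \<eta>_mem_\<Omega> t by (auto simp: region_def mem_\<Omega> stefan_strip_def)
  then have "((\<lambda>y. u y t) has_real_derivative v)
      (at (\<eta> (x y t) t) within (\<lambda>z. \<eta> z t) ` psi_strip X0 X1 t)"
    using DERIV_subset[OF assms(2)] by (simp add: \<eta>_x assms(1))
  from DERIV_image_chain[OF this \<eta>_deriv[OF assms(1)]] show ?thesis
    by (simp add: o_def)
qed

lemma x_mem_strip: "(y, t) \<in> \<Omega> \<Longrightarrow> x y t \<in> psi_strip X0 X1 t"
  by (auto simp: psi_strip_def mem_\<Omega> simp flip: image_x)

section \<open>Motion of the free boundaries\<close>

lemma x_line_deriv:
  assumes "c \<in> {0..1}" "t > 0"
  shows "((\<lambda>t. x (c * S t) t) has_real_derivative
    c * S' t * p (c * S t) t + (p' (c * S t) t - 2 * \<delta> * x (c * S t) t * p (c * S t) t)) (at t)"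
  by (rule has_derivative_scaled_line[OF x_cont p_cont _ x_has_derivative assms])
    (intro continuous_intros x_cont p_cont p'_cont)

lemma X0_deriv:
  assumes t: "t > 0"
  shows "(X0 has_real_derivative p' 0 t - 2 * \<delta> * x 0 t * p 0 t) (at t)"
proof -
  have "(x 0 has_real_derivative p' 0 t - 2 * \<delta> * x 0 t * p 0 t) (at t)"
    using x_line_deriv[of 0 t] t by simp
  then show ?thesis
    by (rule has_field_derivative_transform_within_open[of _ _ _ "{0<..}"]) (use t X0 in auto)
qed

lemma X1_deriv:
  assumes t: "t > 0"
  shows "(X1 has_real_derivative
     S' t * p (S t) t + (p' (S t) t - 2 * \<delta> * x (S t) t * p (S t) t)) (at t)"
proof -
  have "((\<lambda>t. x (S t) t) has_real_derivative
     S' t * p (S t) t + (p' (S t) t - 2 * \<delta> * x (S t) t * p (S t) t)) (at t)"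
    using x_line_deriv[of 1 t] t by simp
  then show ?thesis
    by (rule has_field_derivative_transform_within_open[of _ _ _ "{0<..}"]) (use t X1 in auto)
qed

lemma lower_mem_\<Omega>: "t > 0 \<Longrightarrow> (0, t) \<in> \<Omega>" and upper_mem_\<Omega>: "t > 0 \<Longrightarrow> (S t, t) \<in> \<Omega>"
  using S_pos[of t] by (auto simp: mem_\<Omega>)

lemma X0_continuous: "continuous_on {0<..} X0"
  by (rule continuous_at_imp_continuous_on) (auto intro: DERIV_isCont X0_deriv)

lemma X1_continuous: "continuous_on {0<..} X1"
  by (rule continuous_at_imp_continuous_on) (auto intro: DERIV_isCont X1_deriv)

lemma open_\<Xi>i: "open (region (\<lambda>t. open_segment (X0 t) (X1 t)))"
proof -
  \<comment> \<open>The product of the signed distances to the two ends is negative exactly between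
    them, whichever end is the left one.\<close>
  have "open ((UNIV \<times> {0<..}) \<inter> (\<lambda>z. (fst z - X0 (snd z)) * (fst z - X1 (snd z))) -` {..<0})"
    by (intro continuous_open_preimage continuous_intros continuous_on_compose2[OF X0_continuous]
      continuous_on_compose2[OF X1_continuous] open_Times) auto
  also have "\<dots> = region (\<lambda>t. open_segment (X0 t) (X1 t))"
    using X0_neq_X1 by (auto simp: region_def open_segment_eq_real_ivl mult_less_0_iff split: if_splits)
  finally show ?thesis .
qed

text \<open>Inverse function theorem for \<open>(y, t) -> (x y t, t)\<close>, whose Jacobian
  determinant is \<open>p y t\<close>. At fixed \<open>x\<close> it gives
  \<open>\<eta>_t = - x_t / x_y\<close>, with \<open>x_t\<close> from the Burgers equation.\<close>

lemma \<eta>_has_derivative: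
  assumes yt: "(y, t) \<in> \<Omega>i"
  shows "((\<lambda>z. (\<eta> (fst z) (snd z), snd z)) has_derivative
    (\<lambda>h. ((fst h - (p' y t - 2 * \<delta> * x y t * p y t) * snd h) / p y t, snd h))) (at (x y t, t))"
proof -
  have p: "p y t \<noteq> 0"
    using p_nonzero yt \<Omega>i_subset by blast
  have "((\<lambda>z. (x (fst z) (snd z), snd z)) has_derivative
      (\<lambda>h. (p y t * fst h + (p' y t - 2 * \<delta> * x y t * p y t) * snd h, snd h))) (at (y, t))"
    by (intro has_derivative_Pair x_has_derivative yt derivative_intros)
  moreover have "continuous_on \<Omega>i (\<lambda>z. (x (fst z) (snd z), snd z))"
    by (intro continuous_intros continuous_on_subset[OF x_cont \<Omega>i_subset])
  ultimately show ?thesis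
    using has_derivative_inverse_strong[OF open_\<Omega>i yt, of "\<lambda>z. (x (fst z) (snd z), snd z)"
        "\<lambda>z. (\<eta> (fst z) (snd z), snd z)"] p \<Omega>i_subset
    by (auto simp: \<eta>_x subset_iff fun_eq_iff)
qed

end

text \<open>\<open>\<Psi>\<close> is \<open>1 / x_y\<close> as a function of \<open>x\<close>,
  prescribed on the closed strip and arbitrary outside it.\<close>

locale reciprocal_transform = burgers_strip +
  fixes \<Psi> :: "real \<Rightarrow> real \<Rightarrow> real"
  assumes \<Psi>: "(y, t) \<in> \<Omega> \<Longrightarrow> \<Psi> (x y t) t = 1 / p y t"
begin

lemma \<Psi>_eq: "(z, t) \<in> \<Xi> \<Longrightarrow> \<Psi> z t = 1 / p (\<eta> z t) t"
  by (elim \<Xi>E) (simp add: \<eta>_x \<Psi>)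

lemma \<Psi>_x:
  assumes yt: "(y, t) \<in> \<Omega>"
  shows "((\<lambda>z. \<Psi> z t) has_real_derivative - p' y t / p y t ^ 3) (at (x y t) within psi_strip X0 X1 t)"
proof -
  have "((\<lambda>y. 1 / p y t) has_real_derivative - p' y t / (p y t)\<^sup>2) (at y within {0..S t})"
    using p_y[OF yt] p_nonzero[OF yt] by (auto intro!: derivative_eq_intros simp: power2_eq_square)
  from deriv_along_\<eta>[where u = "\<lambda>y t. 1 / p y t", OF yt this]
  have "((\<lambda>z. 1 / p (\<eta> z t) t) has_real_derivative - p' y t / p y t ^ 3) (at (x y t) within psi_strip X0 X1 t)"
    by (simp add: power3_eq_cube power2_eq_square mult.assoc)
  then show ?thesis
    unfolding has_field_derivative_def
    by (rule has_derivative_transform[rotated 2, OF _ x_mem_strip[OF yt] \<Psi>_eq])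
      (use yt in \<open>auto simp: region_def mem_\<Omega>\<close>)
qed

lemma dspace_\<Psi>:
  assumes yt: "(y, t) \<in> \<Omega>"
  shows "dspace (psi_strip X0 X1) \<Psi> (x y t) t = - p' y t / p y t ^ 3"
proof -
  have t: "t > 0"
    using yt by (simp add: mem_\<Omega>)
  \<comment> \<open>The orientation of the segment is unknown. Within a nondegenerate closed
    interval derivatives are unique, also at its ends.\<close>
  define a b where "a = min (X0 t) (X1 t)" and "b = max (X0 t) (X1 t)"
  have ab: "a < b" "psi_strip X0 X1 t = {a..b}"
    using X0_neq_X1[OF t] by (auto simp: a_def b_def psi_strip_def closed_segment_eq_real_ivl)
  show ?thesis
    unfolding dspace_def
    using vector_derivative_within_closed_interval[OF ab(1), of "x y t" "\<lambda>z. \<Psi> z t"]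
      \<Psi>_x[OF yt] x_mem_strip[OF yt]
    by (simp add: ab(2) has_real_derivative_iff_has_vector_derivative)
qed

lemma \<Psi>_continuous: "continuous_on \<Xi> (\<lambda>z. \<Psi> (fst z) (snd z))"
  by (rule continuous_on_eq[of _ "\<lambda>z. 1 / p (\<eta> (fst z) (snd z)) (snd z)"])
    (use p_nonzero \<eta>_mem_\<Omega> \<Psi>_eq in \<open>auto intro!: continuous_intros continuous_on_\<Xi> p_cont\<close>)

lemma dspace_\<Psi>_continuous: "continuous_on \<Xi> (\<lambda>z. dspace (psi_strip X0 X1) \<Psi> (fst z) (snd z))"
proof (rule continuous_on_eq)
  show "continuous_on \<Xi> (\<lambda>z. - p' (\<eta> (fst z) (snd z)) (snd z) / p (\<eta> (fst z) (snd z)) (snd z) ^ 3)"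
    using p_nonzero \<eta>_mem_\<Omega> by (intro continuous_intros continuous_on_\<Xi> p_cont p'_cont) auto
qed (auto elim!: \<Xi>E simp: dspace_\<Psi> \<eta>_x)

lemma \<Psi>_X0: "t > 0 \<Longrightarrow> \<Psi> (X0 t) t = 1 / p 0 t" and \<Psi>_X1: "t > 0 \<Longrightarrow> \<Psi> (X1 t) t = 1 / p (S t) t"
  by (simp_all add: X0 X1 \<Psi> lower_mem_\<Omega> upper_mem_\<Omega>)

lemma dspace_\<Psi>_X0: "t > 0 \<Longrightarrow> dspace (psi_strip X0 X1) \<Psi> (X0 t) t = - p' 0 t / p 0 t ^ 3"
  and dspace_\<Psi>_X1: "t > 0 \<Longrightarrow> dspace (psi_strip X0 X1) \<Psi> (X1 t) t = - p' (S t) t / p (S t) t ^ 3"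
  by (simp_all add: X0 X1 dspace_\<Psi> lower_mem_\<Omega> upper_mem_\<Omega>)

text \<open>At \<open>y = S t\<close>, the product of \<open>\<Psi>\<close> and the derivative of
  \<open>X1\<close> is \<open>S' + p'/p - 2 \<delta> x\<close>; the other two summands are
  \<open>- p'/p\<close> and \<open>2 \<delta> x\<close>.\<close>

lemma outer_flux_eq:
  assumes t: "t > 0"
  shows "outer_flux \<delta> \<Psi> X0 X1 t = S' t"
  unfolding outer_flux_def DERIV_imp_deriv[OF X1_deriv[OF t]] \<Psi>_X1[OF t] dspace_\<Psi>_X1[OF t]
  unfolding X1[OF t]
  using p_nonzero[OF upper_mem_\<Omega>[OF t]] by (simp add: field_simps power2_eq_square power3_eq_cube)

text \<open>The right-hand side is minus the derivative of \<open>X0\<close>, so the integral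
  formula for \<open>X0\<close> becomes an instance of the fundamental theorem of calculus.\<close>

lemma inner_flux_eq:
  assumes t: "t > 0"
  shows "dspace (psi_strip X0 X1) \<Psi> (X0 t) t / \<Psi> (X0 t) t ^ 3 + 2 * \<delta> * (X0 t / \<Psi> (X0 t) t)
    = - (p' 0 t - 2 * \<delta> * x 0 t * p 0 t)"
  unfolding \<Psi>_X0[OF t] dspace_\<Psi>_X0[OF t]
  unfolding X0[OF t]
  using p_nonzero[OF lower_mem_\<Omega>[OF t]] by (simp add: field_simps power3_eq_cube)

text \<open>Since \<open>\<Psi>_x / \<Psi>^2 = - p'/p\<close>, its x-derivative is
  \<open>(p'^2/p^2 - p''/p) / p\<close>. The time derivative of \<open>1/p\<close> at fixed
  \<open>x\<close> is \<open>- (p_t + p' \<eta>_t) / p^2\<close>: the terms with \<open>x p'\<close>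
  cancel, and \<open>- 2 \<delta> p^2\<close> in \<open>p_t\<close> produces the source
  \<open>2 \<delta>\<close>.\<close>

lemma \<Psi>_equation:
  assumes t: "t > 0" and z: "z \<in> open_segment (X0 t) (X1 t)"
  shows "\<exists>F. ((\<lambda>z. dspace (psi_strip X0 X1) \<Psi> z t / \<Psi> z t ^ 2) has_real_derivative F) (at z) \<and>
    ((\<lambda>\<tau>. \<Psi> z \<tau>) has_real_derivative F + 2 * \<delta>) (at t)"
proof -
  obtain y where y: "y \<in> {0<..<S t}" "z = x y t"
    using z image_x_interior[OF t] by blast
  then have yt: "(y, t) \<in> \<Omega>i" and yt': "(y, t) \<in> \<Omega>"
    using t by (auto simp: mem_\<Omega>i mem_\<Omega>)
  have p: "p y t \<noteq> 0"
    using p_nonzero[OF yt'] .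
  have within: "at z within psi_strip X0 X1 t = at z"
    using z by (auto simp: psi_strip_def closed_segment_eq_real_ivl open_segment_eq_real_ivl
        at_within_Icc_at split: if_splits)
  define F where "F = (p' y t ^ 2 / p y t ^ 2 - p'' y t / p y t) / p y t"
  have "((\<lambda>y. - p' y t / p y t) has_real_derivative p' y t ^ 2 / p y t ^ 2 - p'' y t / p y t) (at y within {0..S t})"
    using p_y[OF yt'] p'_y[OF yt] p unfolding at_within_interior_strip[OF yt]
    by (auto intro!: derivative_eq_intros simp: field_simps power2_eq_square)
  from deriv_along_\<eta>[where u = "\<lambda>y t. - p' y t / p y t", OF yt' this]
  have "((\<lambda>z. - p' (\<eta> z t) t / p (\<eta> z t) t) has_real_derivative F) (at z)"
    unfolding F_def y(2)[symmetric] within .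
  then have 1: "((\<lambda>z. dspace (psi_strip X0 X1) \<Psi> z t / \<Psi> z t ^ 2) has_real_derivative F) (at z)"
  proof (rule has_field_derivative_transform_within_open[where S = "open_segment (X0 t) (X1 t)"])
    fix w assume "w \<in> open_segment (X0 t) (X1 t)"
    then obtain v where v: "w = x v t" "(v, t) \<in> \<Omega>"
      using image_x_interior[OF t] t by (force simp: mem_\<Omega>)
    then show "- p' (\<eta> w t) t / p (\<eta> w t) t = dspace (psi_strip X0 X1) \<Psi> w t / \<Psi> w t ^ 2"
      using p_nonzero[of v t] by (simp add: \<eta>_x dspace_\<Psi> \<Psi> power2_eq_square power3_eq_cube)
  qed (use z in \<open>auto simp: open_segment_eq_real_ivl\<close>)
  have "((\<lambda>\<tau>. (z, \<tau>)) has_derivative (\<lambda>h. (0, h))) (at t)"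
    by (auto intro!: derivative_eq_intros)
  from has_derivative_compose[OF this \<eta>_has_derivative[OF yt, folded y(2)]]
  have "((\<lambda>\<tau>. (\<eta> z \<tau>, \<tau>)) has_derivative
      (\<lambda>h. (- ((p' y t - 2 * \<delta> * z * p y t) * h / p y t), h))) (at t)"
    by simp
  note \<eta>_t = this
  have "((\<lambda>z. p (fst z) (snd z)) has_derivative
      (\<lambda>h. p' y t * fst h + (p'' y t - 2 * \<delta> * ((p y t)\<^sup>2 + x y t * p' y t)) * snd h)) (at (\<eta> z t, t))"
    using p_has_derivative[OF yt] \<eta>_x[OF yt'] y(2) by simp
  from has_derivative_compose[OF \<eta>_t this] have "((\<lambda>\<tau>. p (\<eta> z \<tau>) \<tau>) has_derivative
      (\<lambda>h. p' y t * - ((p' y t - 2 * \<delta> * z * p y t) * h / p y t)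
        + (p'' y t - 2 * \<delta> * ((p y t)\<^sup>2 + x y t * p' y t)) * h)) (at t)"
    by simp
  then have "((\<lambda>\<tau>. p (\<eta> z \<tau>) \<tau>) has_derivative
      (\<lambda>h. (p' y t * - (p' y t - 2 * \<delta> * x y t * p y t) / p y t
        + (p'' y t - 2 * \<delta> * ((p y t)\<^sup>2 + x y t * p' y t))) * h)) (at t)"
    by (rule has_derivative_eq_rhs) (simp add: y(2) fun_eq_iff algebra_simps diff_divide_distrib add_divide_distrib)
  then have "((\<lambda>\<tau>. p (\<eta> z \<tau>) \<tau>) has_real_derivative
      p' y t * - (p' y t - 2 * \<delta> * x y t * p y t) / p y t
        + (p'' y t - 2 * \<delta> * ((p y t)\<^sup>2 + x y t * p' y t))) (at t)"
    unfolding has_field_derivative_def .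
  then have "((\<lambda>\<tau>. 1 / p (\<eta> z \<tau>) \<tau>) has_real_derivative F + 2 * \<delta>) (at t)"
    using p \<eta>_x[OF yt'] unfolding F_def
    by (auto intro!: derivative_eq_intros simp: y(2) field_simps power2_eq_square)
  then have 2: "((\<lambda>\<tau>. \<Psi> z \<tau>) has_real_derivative F + 2 * \<delta>) (at t)"
  proof (rule has_field_derivative_transform_within_open)
    \<comment> \<open>The times at which \<open>z\<close> lies strictly between the free boundaries
      form an open set, so the parametric formula is valid for all times near
      \<open>t\<close>.\<close>
    show "open ((\<lambda>\<tau>. (z, \<tau>)) -` region (\<lambda>t. open_segment (X0 t) (X1 t)))"
      by (rule open_vimage[OF open_\<Xi>i]) (auto intro!: continuous_intros)
    show "1 / p (\<eta> z \<tau>) \<tau> = \<Psi> z \<tau>" if "\<tau> \<in> (\<lambda>\<tau>. (z, \<tau>)) -` region (\<lambda>t. open_segment (X0 t) (X1 t))" for \<tau>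
      using that \<Psi>_eq[of z \<tau>] segment_open_subset_closed by (fastforce simp: region_def psi_strip_def)
  qed (use z t in \<open>auto simp: region_def\<close>)
  show ?thesis
    using 1 2 by blast
qed

end

subsection \<open>The Stefan problem\<close>

text \<open>\<open>R\<close> stands for \<open>C / W 0\<close>, and (ii) compares \<open>R\<close>
  with the exponential of the integral of its logarithmic derivative. From \<open>s > 0\<close> both
  conditions are the fundamental theorem of calculus, with \<open>k = q * R s\<close> absorbing the
  initial value. From 0 they become statements about the limits of \<open>X0\<close> and
  \<open>ln R\<close>.\<close>

lemma inner_conditions_of_derivatives:
  fixes \<delta> q :: real and L Tm C X0 X1 R :: "real \<Rightarrow> real" and \<Psi> :: "real \<Rightarrow> real \<Rightarrow> real"
  defines "G \<equiv> \<lambda>t. dspace (psi_strip X0 X1) \<Psi> (X0 t) t / \<Psi> (X0 t) t ^ 3 + 2 * \<delta> * (X0 t / \<Psi> (X0 t) t)"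
  assumes \<delta>: "\<delta> > 0" and q: "q > 0"
    and C: "\<And>t. t > 0 \<Longrightarrow> C t > 0" and R: "\<And>t. t > 0 \<Longrightarrow> R t > 0"
    and X0_deriv: "\<And>t. t > 0 \<Longrightarrow> (X0 has_real_derivative - G t) (at t)"
    and R_deriv: "\<And>t. t > 0 \<Longrightarrow> (R has_real_derivative R t * H_fun \<delta> L Tm C \<Psi> X0 X1 t) (at t)"
    and eq: "\<And>t. t > 0 \<Longrightarrow> 1 / \<Psi> (X0 t) t - \<delta> * X0 t ^ 2 = - q * R t / (\<delta> * C t)"
  shows inner_conditions_from_pos:
      "\<And>s. s > 0 \<Longrightarrow> inner_conditions_from \<delta> L Tm C \<Psi> X0 X1 s (X0 s) (q * R s)"
    and inner_conditions_from_zero_iff: "inner_conditions_from \<delta> L Tm C \<Psi> X0 X1 0 0 q \<longleftrightarrow>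
      (X0 \<longlongrightarrow> 0) (at_right 0) \<and> (R \<longlongrightarrow> 1) (at_right 0)"
proof -
  define H where "H = H_fun \<delta> L Tm C \<Psi> X0 X1"
  have ln_R_deriv: "((\<lambda>t. ln (R t)) has_real_derivative H t) (at t)" if "t > 0" for t
    using R_deriv[OF that] R[OF that] by (auto intro!: derivative_eq_intros simp: H_def)
  have X0_deriv': "((\<lambda>t. - X0 t) has_real_derivative G t) (at t)" if "t > 0" for t
    using DERIV_minus[OF X0_deriv[OF that]] by simp
  have integral: "(f has_integral F t - F s) {s..t}"
    if "\<And>t. t > 0 \<Longrightarrow> (F has_real_derivative f t) (at t)" "s > 0" "s < t" for F f :: "real \<Rightarrow> real" and s t
    using that by (intro fundamental_theorem_of_calculus)
      (auto simp: has_real_derivative_iff_has_vector_derivative intro: has_vector_derivative_at_within)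
  show "inner_conditions_from \<delta> L Tm C \<Psi> X0 X1 s (X0 s) (q * R s)" if s: "s > 0" for s
  proof -
    have "G integrable_on {s..t} \<and> X0 t = X0 s - integral {s..t} G" if t: "t > s" for t
      using integral[OF X0_deriv' s t] by (auto simp: integral_unique has_integral_integrable)
    moreover have "H integrable_on {s..t} \<and>
        1 / \<Psi> (X0 t) t - \<delta> * X0 t ^ 2 = - (q * R s) * exp (integral {s..t} H) / (\<delta> * C t)" if t: "t > s" for t
    proof -
      have "exp (integral {s..t} H) = R t / R s"
        using integral[OF ln_R_deriv s t] R[OF s] R[of t] s t by (simp add: integral_unique exp_diff)
      then show ?thesis
        using integral[OF ln_R_deriv s t] eq[of t] R[OF s] s t by (auto simp: has_integral_integrable)
    qed
    ultimately show ?thesis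
      unfolding inner_conditions_from_def Let_def G_def H_def by blast
  qed
  \<comment> \<open>Cancelling \<open>q\<close>, \<open>\<delta>\<close> and \<open>C t\<close>
    brings (ii) into the form \<open>F t = integral {0..t} f\<close> of the limit criterion, with
    \<open>F = ln R\<close>.\<close>
  have "(1 / \<Psi> (X0 t) t - \<delta> * X0 t ^ 2 = - q * exp I / (\<delta> * C t)) \<longleftrightarrow> ln (R t) = I" if t: "t > 0" for t I
  proof -
    have "(1 / \<Psi> (X0 t) t - \<delta> * X0 t ^ 2 = - q * exp I / (\<delta> * C t)) \<longleftrightarrow> R t = exp I"
      unfolding eq[OF t] using \<delta> q C[OF t] by simp
    also have "\<dots> \<longleftrightarrow> ln (R t) = I"
      using R[OF t] by (metis exp_ln ln_exp)
    finally show ?thesis .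
  qed
  then have "inner_conditions_from \<delta> L Tm C \<Psi> X0 X1 0 0 q \<longleftrightarrow>
      (\<forall>t>0. G integrable_on {0..t} \<and> - X0 t = integral {0..t} G) \<and>
      (\<forall>t>0. H integrable_on {0..t} \<and> ln (R t) = integral {0..t} H)"
    unfolding inner_conditions_from_def Let_def G_def[symmetric] H_def[symmetric]
    by (auto simp: eq_commute[of "X0 _"] neg_equal_iff_equal minus_equation_iff[of "X0 _"])
  also have "\<dots> \<longleftrightarrow> ((\<lambda>t. - X0 t) \<longlongrightarrow> 0) (at_right 0) \<and> ((\<lambda>t. ln (R t)) \<longlongrightarrow> 0) (at_right 0)"
    by (simp only: tendsto_zero_iff_integral_of_derivative X0_deriv' ln_R_deriv)
  also have "((\<lambda>t. - X0 t) \<longlongrightarrow> 0) (at_right 0) \<longleftrightarrow> (X0 \<longlongrightarrow> 0) (at_right 0)"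
    using tendsto_minus_cancel_left[of X0 0 "at_right 0"] by simp
  also have "((\<lambda>t. ln (R t)) \<longlongrightarrow> 0) (at_right 0) \<longleftrightarrow> (R \<longlongrightarrow> 1) (at_right 0)"
  proof
    assume "((\<lambda>t. ln (R t)) \<longlongrightarrow> 0) (at_right 0)"
    then have "((\<lambda>t. exp (ln (R t))) \<longlongrightarrow> exp 0) (at_right 0)"
      by (rule tendsto_exp)
    moreover have "eventually (\<lambda>t. exp (ln (R t)) = R t) (at_right 0)"
      using eventually_at_right_less[of 0] by eventually_elim (simp add: R)
    ultimately have "(R \<longlongrightarrow> exp 0) (at_right 0)"
      by (rule Lim_transform_eventually)
    then show "(R \<longlongrightarrow> 1) (at_right 0)"
      by simp
  next
    assume "(R \<longlongrightarrow> 1) (at_right 0)"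
    from tendsto_ln[OF this] show "((\<lambda>t. ln (R t)) \<longlongrightarrow> 0) (at_right 0)"
      by simp
  qed
  finally show "inner_conditions_from \<delta> L Tm C \<Psi> X0 X1 0 0 q \<longleftrightarrow>
      (X0 \<longlongrightarrow> 0) (at_right 0) \<and> (R \<longlongrightarrow> 1) (at_right 0)" .
qed

text \<open>By the bijection the parametric formula fixes \<open>\<Psi>\<close> on the closed strip;
  its values elsewhere are free, hence the quantifier over \<open>\<Psi>\<close>. The integral
  conditions appear twice: started at any \<open>s > 0\<close> from the data found there, and
  started at 0, where the initial data are limits.\<close>

theorem theorem3p3:
  fixes \<delta> q :: real
    and L Tm S C X0 X1 :: "real \<Rightarrow> real"
    and T Ty W xs :: "real \<Rightarrow> real \<Rightarrow> real"
  assumes "\<delta> > 0" and "q > 0"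
    and "stefan_solution q L Tm T S"
    and "Ty = dspace (stefan_strip S) T"
    and "\<forall>t>0. L t \<noteq> 0"
    and "\<forall>t>0. (\<lambda>\<tau>. (L \<tau> - Tm \<tau>) * deriv S \<tau>) integrable_on {0..t}"
    and "\<forall>t\<ge>0. C t = integral {0..t} (\<lambda>\<tau>. (L \<tau> - Tm \<tau>) * deriv S \<tau>)"
    and "\<forall>t>0. C t > 0"
    \<comment> \<open>W is C(t) minus the integral of T from S(t) to y, here with y at most S(t)\<close>
    and "\<forall>t>0. \<forall>y\<in>{0..S t}. W y t = C t + integral {y..S t} (\<lambda>u. T u t)"
    \<comment> \<open>the denominators in the parametric expression do not vanish\<close>
    and "\<forall>t>0. \<forall>y\<in>{0..S t}. W y t \<noteq> 0 \<and> Ty y t * W y t + T y t ^ 2 \<noteq> 0"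
    and "\<forall>t>0. \<forall>y\<in>{0..S t}. xs y t = T y t / (\<delta> * W y t)"
    and "\<forall>t>0. X0 t = T 0 t / (\<delta> * W 0 t)"
    and "\<forall>t>0. X1 t = Tm t / (\<delta> * C t)"
  shows "(\<forall>t>0. bij_betw (\<lambda>y. xs y t) {0..S t} (closed_segment (X0 t) (X1 t))) \<and>
    (\<forall>\<Psi>. (\<forall>t>0. \<forall>y\<in>{0..S t}.
            \<Psi> (xs y t) t = \<delta> * W y t ^ 2 / (Ty y t * W y t + T y t ^ 2)) \<longrightarrow>
      psi_equations \<delta> L Tm C \<Psi> X0 X1 \<and>
      (\<forall>s>0. inner_conditions_from \<delta> L Tm C \<Psi> X0 X1 s (X0 s) (q * C s / W 0 s)) \<and>
      \<comment> \<open>from s = 0 on: exactly under compatibility of the data at t = 0\<close>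
      (psi_problem \<delta> q L Tm C \<Psi> X0 X1 \<longleftrightarrow>
         (X0 \<longlongrightarrow> 0) (at_right 0) \<and> ((\<lambda>t. C t / W 0 t) \<longlongrightarrow> 1) (at_right 0)))"
proof -

  \<comment> \<open>Derivatives of the temperature\<close>
  define Tyy where "Tyy = dspace (stefan_strip S) Ty"
  define Tyyy where "Tyyy = dspace (stefan_strip S) Tyy"
  define S' where "S' = deriv S"
  note [simp] = stefan_strip_def
  note stefan = assms(3)[unfolded stefan_solution_def Let_def, folded assms(4), folded Tyy_def, folded Tyyy_def S'_def]
  have \<delta>: "\<delta> > 0" and q: "q > 0"
    by fact+
  have C_pos: "C t > 0" if "t > 0" for t
    using assms(8) that by blast
  interpret moving_strip S S'
    using stefan by unfold_locales (auto simp: S'_def DERIV_deriv_iff_real_differentiable)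
  have T_cont: "continuous_on \<Omega> (\<lambda>z. T (fst z) (snd z))"
    and Ty_cont: "continuous_on \<Omega> (\<lambda>z. Ty (fst z) (snd z))"
    and Tyy_cont: "continuous_on \<Omega> (\<lambda>z. Tyy (fst z) (snd z))"
    and Tyyy_cont: "continuous_on \<Omega>i (\<lambda>z. Tyyy (fst z) (snd z))"
    using stefan unfolding split_beta by blast+
  have T_y: "((\<lambda>y. T y t) has_real_derivative Ty y t) (at y within {0..S t})" if "(y, t) \<in> \<Omega>" for y t
  proof -
    have "(\<lambda>y. T y t) differentiable (at y within {0..S t})"
      using stefan that by (auto simp: mem_\<Omega> differentiable_on_def)
    then show ?thesis
      by (simp add: vector_derivative_works has_real_derivative_iff_has_vector_derivative assms(4) dspace_def)
  qed
  have Ty_y: "((\<lambda>y. Ty y t) has_real_derivative Tyy y t) (at y within {0..S t})" if "(y, t) \<in> \<Omega>" for y t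
  proof -
    have "(\<lambda>y. Ty y t) differentiable (at y within {0..S t})"
      using stefan that by (auto simp: mem_\<Omega> differentiable_on_def)
    then show ?thesis
      by (simp add: vector_derivative_works has_real_derivative_iff_has_vector_derivative Tyy_def dspace_def)
  qed
  have Tyy_y: "((\<lambda>y. Tyy y t) has_real_derivative Tyyy y t) (at y)" if "(y, t) \<in> \<Omega>i" for y t
  proof -
    have "(\<lambda>y. Tyy y t) differentiable (at y)"
      using stefan that by (auto simp: mem_\<Omega>i)
    then show ?thesis
      using at_within_interior_strip[OF that]
      by (simp add: vector_derivative_works has_real_derivative_iff_has_vector_derivative Tyyy_def dspace_def)
  qed
  have T_t: "((\<lambda>t. T y t) has_real_derivative Tyy y t) (at t)" if "(y, t) \<in> \<Omega>i" for y t
    using stefan that by (auto simp: mem_\<Omega>i)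
  have T_yi: "((\<lambda>y. T y t) has_real_derivative Ty y t) (at y)"
    and Ty_yi: "((\<lambda>y. Ty y t) has_real_derivative Tyy y t) (at y)" if "(y, t) \<in> \<Omega>i" for y t
    using T_y[of y t] Ty_y[of y t] that \<Omega>i_subset at_within_interior_strip[OF that] by auto
  have Ty_t: "((\<lambda>t. Ty y t) has_real_derivative Tyyy y t) (at t)" if "(y, t) \<in> \<Omega>i" for y t
    by (rule has_real_derivative_mixed_partial[OF open_\<Omega>i that T_yi T_t Tyy_y Tyyy_cont])
  have T_diff: "((\<lambda>z. T (fst z) (snd z)) has_derivative (\<lambda>h. Ty y t * fst h + Tyy y t * snd h)) (at (y, t))"
    if "(y, t) \<in> \<Omega>i" for y t
    by (rule has_derivative_of_partials_open[OF open_\<Omega>i that T_yi T_t])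
      (assumption | rule that continuous_on_subset[OF Tyy_cont \<Omega>i_subset])+
  have Ty_diff: "((\<lambda>z. Ty (fst z) (snd z)) has_derivative (\<lambda>h. Tyy y t * fst h + Tyyy y t * snd h)) (at (y, t))"
    if "(y, t) \<in> \<Omega>i" for y t
    by (rule has_derivative_of_partials_open[OF open_\<Omega>i that Ty_yi Ty_t]) (assumption | rule that Tyyy_cont)+
  have T_S: "T (S t) t = Tm t" and Ty_S: "Ty (S t) t = - (L t * S' t)" and Ty_0: "Ty 0 t = - q" if "t > 0" for t
  proof -
    have "- Ty (S t) t = L t * S' t" "T (S t) t = Tm t" "Ty 0 t = - q"
      using stefan that by blast+
    then show "T (S t) t = Tm t" "Ty (S t) t = - (L t * S' t)" "Ty 0 t = - q"
      by linarith+
  qed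

  \<comment> \<open>The function \<open>C\<close>\<close>
  define C' where "C' t = (L t - Tm t) * S' t" for t
  \<comment> \<open>The Stefan condition enters here: it matches \<open>C\<close> with the flux at
    \<open>y = S t\<close>, as the heat equation for \<open>W\<close> requires.\<close>
  have C'_eq: "C' t = - (S' t * T (S t) t) - Ty (S t) t" if "t > 0" for t
    using T_S[OF that] Ty_S[OF that] by (simp add: C'_def algebra_simps)
  \<comment> \<open>No continuity is assumed of \<open>L\<close> and \<open>Tm\<close>; that of
    \<open>C'\<close> comes from the boundary values of \<open>T\<close> and \<open>Ty\<close> and
    from \<open>S'\<close>.\<close>
  have C'_cont: "continuous_on {0<..} C'"
  proof (rule continuous_on_eq)
    show "continuous_on {0<..} (\<lambda>t. - (S' t * T (1 * S t) t) - Ty (1 * S t) t)"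
      by (intro continuous_intros S'_cont continuous_on_scaled_line T_cont Ty_cont) auto
  qed (simp add: C'_eq)
  have C'_int: "C' integrable_on {0..t}" if "t > 0" for t
    using assms(6) that unfolding C'_def S'_def by blast
  have C_eq: "C t = integral {0..t} C'" if "t \<ge> 0" for t
    using assms(7) that unfolding C'_def S'_def by blast
  have C_deriv: "(C has_real_derivative C' t) (at t)" if t: "t > 0" for t
  proof -
    have "isCont C' t"
      using C'_cont t by (simp add: continuous_on_eq_continuous_at)
    then have "((\<lambda>t. integral {0..t} C') has_vector_derivative C' t) (at t within {0..2 * t} - {})"
      using t by (intro integral_has_vector_derivative_continuous_at C'_int)
        (auto intro: continuous_at_imp_continuous_within)
    then have "((\<lambda>t. integral {0..t} C') has_real_derivative C' t) (at t)"
      using t by (simp add: has_real_derivative_iff_has_vector_derivative at_within_Icc_at)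
    then show ?thesis
      by (rule has_field_derivative_transform_within_open[of _ _ _ "{0<..}"]) (use t C_eq in auto)
  qed
  \<comment> \<open>\<open>C'\<close> may be unbounded near 0; continuity there is that of an
    indefinite Henstock-Kurzweil integral.\<close>
  have C_cont: "continuous_on {0..} C"
    unfolding continuous_on_eq_continuous_within
  proof
    fix t :: real assume t: "t \<in> {0..}"
    have "continuous_on {0..t + 1} C"
      by (rule continuous_on_eq[OF indefinite_integral_continuous_1[OF C'_int]]) (use t C_eq in auto)
    then have "continuous (at t within {0..t + 1}) C"
      using t by (auto simp: continuous_on_eq_continuous_within)
    moreover have "at t within {0..t + 1} = at t within {0..}"
      by (rule at_within_nhd[of _ "{..<t + 1}"]) auto
    ultimately show "continuous (at t within {0..}) C"
      by simp
  qed

  \<comment> \<open>The potential \<open>W\<close>\<close>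
  have W_eq: "W y t = C t + integral {y..S t} (\<lambda>u. T u t)" if "(y, t) \<in> \<Omega>" for y t
    using assms(9) that by (auto simp: mem_\<Omega>)
  note potential = T_cont Ty_cont Tyy_cont T_y Ty_y T_diff C_deriv C'_eq W_eq
  have W_y: "((\<lambda>y. W y t) has_real_derivative - T y t) (at y within {0..S t})" if "(y, t) \<in> \<Omega>" for y t
    by (rule heat_potential_y[OF potential]) (use that in auto)
  \<comment> \<open>The boundary line \<open>c = 0\<close>; by the flux condition at
    \<open>y = 0\<close> this derivative is the constant \<open>q\<close>.\<close>
  have W_0_deriv: "(W 0 has_real_derivative - Ty 0 t) (at t)" if "t > 0" for t
    using heat_potential_line[OF potential, of 0 t] that by simp
  have W_cont: "continuous_on \<Omega> (\<lambda>z. W (fst z) (snd z))"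
    by (rule heat_potential_continuous[OF potential])
  have W_diff: "((\<lambda>z. W (fst z) (snd z)) has_derivative (\<lambda>h. - T y t * fst h + - Ty y t * snd h)) (at (y, t))"
    if "(y, t) \<in> \<Omega>i" for y t
    by (rule heat_potential_has_derivative[OF potential]) (use that in auto)
  have W_nz: "W y t \<noteq> 0" and den_nz: "Ty y t * W y t + T y t ^ 2 \<noteq> 0" if "(y, t) \<in> \<Omega>" for y t
    using assms(10) that by (auto simp: mem_\<Omega>)
  have W_S: "W (S t) t = C t" if "t > 0" for t
    using W_eq[of "S t" t] S_pos[OF that] that by (simp add: mem_\<Omega>)
  \<comment> \<open>\<open>W\<close> is continuous in \<open>y\<close>, has no zero and equals
    \<open>C t > 0\<close> at \<open>y = S t\<close>, so it cannot change sign.\<close>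
  have W_0_pos: "W 0 t > 0" if t: "t > 0" for t
  proof (rule ccontr)
    assume "\<not> W 0 t > 0"
    then obtain y where "0 \<le> y" "y \<le> S t" "W y t = 0"
      using IVT'[of "\<lambda>y. W y t" 0 0 "S t"] continuous_on_slice[OF W_cont t] S_pos[OF t] W_S[OF t] C_pos[OF t]
      by auto
    then show False
      using W_nz[of y t] t by (simp add: mem_\<Omega>)
  qed

  \<comment> \<open>The Cole-Hopf transformation\<close>
  define V where "V y t = 1 / W y t" for y t
  have V_y: "((\<lambda>y. V y t) has_real_derivative T y t * V y t ^ 2) (at y within {0..S t})" if "(y, t) \<in> \<Omega>" for y t
    unfolding V_def using W_nz[OF that] W_y[OF that]
    by (auto intro!: derivative_eq_intros simp: power2_eq_square)
  have V_diff: "((\<lambda>z. V (fst z) (snd z)) has_derivative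
      (\<lambda>h. T y t * V y t ^ 2 * fst h + Ty y t * V y t ^ 2 * snd h)) (at (y, t))" if yt: "(y, t) \<in> \<Omega>i" for y t
  proof -
    have "W y t \<noteq> 0"
      using W_nz yt \<Omega>i_subset by blast
    then show ?thesis
      unfolding V_def using W_diff[OF yt]
      by (auto intro!: derivative_eq_intros simp: fun_eq_iff field_simps power2_eq_square)
  qed
  have V_cont: "continuous_on \<Omega> (\<lambda>z. V (fst z) (snd z))"
    unfolding V_def using W_nz by (auto intro!: continuous_intros W_cont)
  \<comment> \<open>With \<open>V = 1 / W\<close>, for which \<open>V_y = T V^2\<close> and
    \<open>V_t = Ty V^2\<close>, everything is a polynomial in \<open>V\<close>, \<open>T\<close>
    and derivatives of \<open>T\<close>. The functions \<open>p\<close>, \<open>p'\<close>,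
    \<open>p''\<close> are the successive y-derivatives of \<open>x\<close>.\<close>
  define x where "x y t = T y t * V y t / \<delta>" for y t
  define p where "p y t = (Ty y t * V y t + T y t ^ 2 * V y t ^ 2) / \<delta>" for y t
  define p' where "p' y t = (Tyy y t * V y t + 3 * T y t * Ty y t * V y t ^ 2 + 2 * T y t ^ 3 * V y t ^ 3) / \<delta>" for y t
  define p'' where "p'' y t = (Tyyy y t * V y t + (4 * T y t * Tyy y t + 3 * Ty y t ^ 2) * V y t ^ 2
    + 12 * T y t ^ 2 * Ty y t * V y t ^ 3 + 6 * T y t ^ 4 * V y t ^ 4) / \<delta>" for y t
  have p_eq: "\<delta> * W y t ^ 2 / (Ty y t * W y t + T y t ^ 2) = 1 / p y t" if "(y, t) \<in> \<Omega>" for y t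
    using W_nz[OF that] \<delta> by (simp add: p_def V_def field_simps power2_eq_square)
  have xs_eq: "xs y t = x y t" if "(y, t) \<in> \<Omega>" for y t
    using assms(11) that by (auto simp: x_def V_def mem_\<Omega>)
  interpret burgers_strip S S' \<delta> x p p' p'' X0 X1
  proof unfold_locales
    show "continuous_on \<Omega> (\<lambda>z. x (fst z) (snd z))" "continuous_on \<Omega> (\<lambda>z. p (fst z) (snd z))"
      "continuous_on \<Omega> (\<lambda>z. p' (fst z) (snd z))"
      using \<delta> unfolding x_def p_def p'_def
      by (auto intro!: continuous_intros T_cont Ty_cont Tyy_cont V_cont)
    fix y t
    show "X0 t = x 0 t" "X1 t = x (S t) t" if "t > 0"
      using that assms(12,13) by (simp_all add: x_def V_def W_S T_S)
    \<comment> \<open>\<open>p\<close> is the denominator of the parametric expression divided by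
      \<open>\<delta> W^2\<close>.\<close>
    show "p y t \<noteq> 0" if "(y, t) \<in> \<Omega>"
      using W_nz[OF that] den_nz[OF that] \<delta> by (simp add: p_def V_def field_simps power2_eq_square)
    show "((\<lambda>y. x y t) has_real_derivative p y t) (at y within {0..S t})" if "(y, t) \<in> \<Omega>"
      unfolding x_def p_def using \<delta> T_y[OF that] V_y[OF that]
      by (auto intro!: derivative_eq_intros simp: field_simps power2_eq_square)
    show "((\<lambda>y. p y t) has_real_derivative p' y t) (at y within {0..S t})" if "(y, t) \<in> \<Omega>"
      unfolding p'_def p_def using \<delta> T_y[OF that] Ty_y[OF that] V_y[OF that]
      by (auto intro!: derivative_eq_intros simp: field_simps power2_eq_square power3_eq_cube)
    assume yt: "(y, t) \<in> \<Omega>i"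
    have V_yi: "((\<lambda>y. V y t) has_real_derivative T y t * V y t ^ 2) (at y)"
      using V_y[of y t] yt \<Omega>i_subset at_within_interior_strip[OF yt] by auto
    show "((\<lambda>y. p' y t) has_real_derivative p'' y t) (at y)"
      unfolding p''_def p'_def using \<delta> T_yi[OF yt] Ty_yi[OF yt] Tyy_y[OF yt] V_yi
      by (auto intro!: derivative_eq_intros simp: field_simps power2_eq_square power3_eq_cube power4_eq_xxxx)
    \<comment> \<open>The Burgers equation: direct computation gives
      \<open>x_t = (Tyy V + T Ty V^2) / \<delta>\<close>, and \<open>p' - 2 \<delta> x p\<close>
      reduces to the same.\<close>
    show "((\<lambda>z. x (fst z) (snd z)) has_derivative
        (\<lambda>h. p y t * fst h + (p' y t - 2 * \<delta> * x y t * p y t) * snd h)) (at (y, t))"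
      unfolding p'_def p_def x_def divide_inverse
      apply (rule has_derivative_eq_rhs)
       apply (rule derivative_intros T_diff[OF yt] V_diff[OF yt])+
      using \<delta> by (auto simp: fun_eq_iff field_simps power2_eq_square power3_eq_cube)
    \<comment> \<open>Here \<open>Tyyy\<close> serves as the time derivative of \<open>Ty\<close>;
      the coefficient is the y-derivative of the right-hand side of the Burgers equation.\<close>
    show "((\<lambda>z. p (fst z) (snd z)) has_derivative
        (\<lambda>h. p' y t * fst h + (p'' y t - 2 * \<delta> * ((p y t)\<^sup>2 + x y t * p' y t)) * snd h)) (at (y, t))"
      unfolding p''_def p'_def p_def x_def divide_inverse
      apply (rule has_derivative_eq_rhs)
       apply (rule derivative_intros T_diff[OF yt] Ty_diff[OF yt] V_diff[OF yt])+
      using \<delta> by (auto simp: fun_eq_iff field_simps power2_eq_square power3_eq_cube power4_eq_xxxx)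
  qed

  \<comment> \<open>The problem for \<open>\<Psi>\<close>\<close>
  have "bij_betw (\<lambda>y. xs y t) {0..S t} (closed_segment (X0 t) (X1 t))" if t: "t > 0" for t
    using bij_betw_x[OF t] xs_eq t by (subst bij_betw_cong[of _ _ "\<lambda>y. x y t"]) (auto simp: mem_\<Omega>)
  moreover have "psi_equations \<delta> L Tm C \<Psi> X0 X1 \<and>
      (\<forall>s>0. inner_conditions_from \<delta> L Tm C \<Psi> X0 X1 s (X0 s) (q * C s / W 0 s)) \<and>
      (psi_problem \<delta> q L Tm C \<Psi> X0 X1 \<longleftrightarrow>
         (X0 \<longlongrightarrow> 0) (at_right 0) \<and> ((\<lambda>t. C t / W 0 t) \<longlongrightarrow> 1) (at_right 0))"
    if \<Psi>: "\<forall>t>0. \<forall>y\<in>{0..S t}. \<Psi> (xs y t) t = \<delta> * W y t ^ 2 / (Ty y t * W y t + T y t ^ 2)" for \<Psi>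
  proof -
    interpret reciprocal_transform S S' \<delta> x p p' p'' X0 X1 \<Psi>
      by unfold_locales (use \<Psi> in \<open>simp flip: xs_eq p_eq add: mem_\<Omega>\<close>)
    \<comment> \<open>The quadratic term of \<open>p\<close> is exactly \<open>\<delta> x^2\<close>,
      so \<open>p - \<delta> x^2 = Ty / (\<delta> W)\<close>; the flux conditions at
      \<open>y = 0\<close> and \<open>y = S t\<close> then yield the left-hand sides of (ii) and
      (i).\<close>
    have p_0: "p 0 t - \<delta> * x 0 t ^ 2 = - q / (\<delta> * W 0 t)" if "t > 0" for t
      using Ty_0[OF that] W_0_pos[OF that] \<delta> by (simp add: p_def x_def V_def field_simps power2_eq_square)
    have p_S: "p (S t) t - \<delta> * x (S t) t ^ 2 = - (L t / (\<delta> * C t)) * S' t" if "t > 0" for t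
      using Ty_S[OF that] W_S[OF that] C_pos[OF that] \<delta>
      by (simp add: p_def x_def V_def field_simps power2_eq_square)
    have "psi_equations \<delta> L Tm C \<Psi> X0 X1"
      unfolding psi_equations_def Let_def
    proof (intro conjI)
      show "C 0 = 0"
        using C_eq[of 0] by simp
      show "\<forall>t>0. X0 t \<noteq> X1 t \<and> X0 differentiable at t \<and> X1 differentiable at t"
        using X0_neq_X1 X0_deriv X1_deriv by (auto simp: real_differentiable_def)
      show "\<forall>t>0. (\<forall>z\<in>psi_strip X0 X1 t. \<Psi> z t \<noteq> 0) \<and> (\<lambda>z. \<Psi> z t) differentiable_on psi_strip X0 X1 t"
      proof (intro allI impI conjI ballI)
        fix t z :: real assume "t > 0" "z \<in> psi_strip X0 X1 t"
        then obtain y where "(y, t) \<in> \<Omega>" "z = x y t"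
          by (elim \<Xi>E[of z t, rotated]) (auto simp: region_def)
        then show "\<Psi> z t \<noteq> 0"
          using p_nonzero by (simp add: local.\<Psi>)
      next
        fix t :: real assume t: "t > 0"
        show "(\<lambda>z. \<Psi> z t) differentiable_on psi_strip X0 X1 t"
          unfolding differentiable_on_def
        proof
          fix z assume "z \<in> psi_strip X0 X1 t"
          then obtain y where "(y, t) \<in> \<Omega>" "z = x y t"
            using t by (elim \<Xi>E[of z t, rotated]) (auto simp: region_def)
          then show "(\<lambda>z. \<Psi> z t) differentiable at z within psi_strip X0 X1 t"
            using \<Psi>_x real_differentiable_def by blast
        qed
      qed
      show "\<forall>t>0. 1 / \<Psi> (X1 t) t - \<delta> * X1 t ^ 2 = - (L t / (\<delta> * C t)) * outer_flux \<delta> \<Psi> X0 X1 t"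
      proof (intro allI impI)
        fix t :: real assume t: "t > 0"
        show "1 / \<Psi> (X1 t) t - \<delta> * X1 t ^ 2 = - (L t / (\<delta> * C t)) * outer_flux \<delta> \<Psi> X0 X1 t"
          unfolding \<Psi>_X1[OF t] outer_flux_eq[OF t] unfolding X1[OF t] using p_S[OF t] by simp
      qed
      show "\<forall>t>0. (C has_real_derivative (L t - Tm t) * outer_flux \<delta> \<Psi> X0 X1 t) (at t)"
        using C_deriv by (simp add: outer_flux_eq C'_def)
    qed (use C_cont C_pos assms(13) \<Psi>_continuous dspace_\<Psi>_continuous \<Psi>_equation in
        \<open>auto simp: split_beta\<close>)
    moreover have "(\<forall>s>0. inner_conditions_from \<delta> L Tm C \<Psi> X0 X1 s (X0 s) (q * (C s / W 0 s))) \<and>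
      (inner_conditions_from \<delta> L Tm C \<Psi> X0 X1 0 0 q \<longleftrightarrow>
         (X0 \<longlongrightarrow> 0) (at_right 0) \<and> ((\<lambda>t. C t / W 0 t) \<longlongrightarrow> 1) (at_right 0))"
    proof -
      have X0': "(X0 has_real_derivative - (dspace (psi_strip X0 X1) \<Psi> (X0 t) t / \<Psi> (X0 t) t ^ 3
          + 2 * \<delta> * (X0 t / \<Psi> (X0 t) t))) (at t)" if t: "t > 0" for t
        unfolding inner_flux_eq[OF t] using X0_deriv[OF t] by simp
      \<comment> \<open>After insertion of the boundary values the terms with \<open>Tm^3\<close>
        and \<open>Tm^2\<close> cancel. Since \<open>W 0\<close> has derivative \<open>q\<close>,
        what remains is the logarithmic derivative of \<open>C / W 0\<close>.\<close>
      have H: "H_fun \<delta> L Tm C \<Psi> X0 X1 t = C' t / C t - q / W 0 t" if t: "t > 0" for t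
      proof -
        have L: "L t \<noteq> 0"
          using assms(5) t by blast
        have outer: "\<delta> * p (S t) t = Tm t ^ 2 / C t ^ 2 - L t * S' t / C t"
          using Ty_S[OF t] T_S[OF t] W_S[OF t] \<delta> by (simp add: p_def V_def power_one_over divide_inverse power_inverse)
        have inner: "\<delta> * p 0 t - \<delta>\<^sup>2 * x 0 t ^ 2 = - q / W 0 t"
          using p_0[OF t] W_0_pos[OF t] \<delta> by (simp add: field_simps power2_eq_square)
        have H_eq: "H_fun \<delta> L Tm C \<Psi> X0 X1 t = - (Tm t ^ 3 / (L t * C t ^ 2)) + Tm t / L t * (\<delta> * p (S t) t)
            - \<delta> * p (S t) t + Tm t ^ 2 / C t ^ 2 + (\<delta> * p 0 t - \<delta>\<^sup>2 * x 0 t ^ 2)"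
          unfolding H_fun_def \<Psi>_X0[OF t] \<Psi>_X1[OF t] unfolding X0[OF t] by simp
        show ?thesis
          unfolding H_eq unfolding outer inner using L C_pos[OF t] W_0_pos[OF t] by (simp add: C'_def field_simps power2_eq_square power3_eq_cube)
      qed
      have R': "((\<lambda>t. C t / W 0 t) has_real_derivative C t / W 0 t * H_fun \<delta> L Tm C \<Psi> X0 X1 t) (at t)"
        if t: "t > 0" for t
        using C_deriv[OF t] W_0_deriv[OF t] W_0_pos[OF t] C_pos[OF t] Ty_0[OF t] unfolding H[OF t]
        by (auto intro!: derivative_eq_intros simp: field_simps)
      have eq: "1 / \<Psi> (X0 t) t - \<delta> * X0 t ^ 2 = - q * (C t / W 0 t) / (\<delta> * C t)" if t: "t > 0" for t
        unfolding \<Psi>_X0[OF t] unfolding X0[OF t] using p_0[OF t] C_pos[OF t] by simp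
      have R: "C t / W 0 t > 0" if "t > 0" for t
        using C_pos[OF that] W_0_pos[OF that] by simp
      note inner = \<delta> q C_pos R X0' R' eq
      show ?thesis
        using inner_conditions_from_pos[OF inner] inner_conditions_from_zero_iff[OF inner] by blast
    qed
    ultimately show ?thesis
      unfolding psi_problem_def by simp
  qed
  ultimately show ?thesis
    by blast
qed

end
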